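(* Let $Y$ be a Banach space which is a quotient of the Schreier space $S$. Then $Y$ is $c_0$-saturated, i.e. every infinite dimensional (closed) subspace of $Y$ contains a subspace isomorphic to $c_0$.
   Context: Let $c_{00}$ be the space of finitely supported real sequences. For $x=(x_i)\in c_{00}$ set $\|x\|=\max\{\sum_{i=1}^p |x_{k_i}| : p\in\mathbb{N},\ p\le k_1<k_2<\cdots<k_p\}$. The Schreier space $S$ is the completion of $(c_{00},\|\cdot\|)$. $Y$ is a quotient of $S$ if there is a bounded linear operator from $S$ onto $Y$. *)

theory Defs
  imports "HOL-Analysis.Analysis"
begin

text \<open>Sequences are indexed from 0 here; index i stands for the paper's index i+1.
  A finite set F of indices is Schreier-admissible iff it is nonempty and
  card F \<le> (least element of F) + 1 (i.e. p \<le> k_1 in the paper's 1-based indexing).\<close>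

definition schreier_admissible :: "nat set \<Rightarrow> bool" where
  "schreier_admissible F \<longleftrightarrow> finite F \<and> F \<noteq> {} \<and> card F \<le> Min F + 1"

text \<open>Schreier norm of an arbitrary real sequence (possibly infinite, hence ereal).\<close>
definition schreier_norm :: "(nat \<Rightarrow> real) \<Rightarrow> ereal" where
  "schreier_norm x = (SUP F \<in> {F. schreier_admissible F}. ereal (\<Sum>k\<in>F. \<bar>x k\<bar>))"

definition finitely_supported :: "(nat \<Rightarrow> real) \<Rightarrow> bool" where
  "finitely_supported y \<longleftrightarrow> finite {n. y n \<noteq> 0}"

text \<open>The Schreier space S: the completion of (c00, Schreier norm), realised concretely
  as the closure of c00 in the Schreier norm.\<close>
definition schreier_space :: "(nat \<Rightarrow> real) set" where
  "schreier_space = {x. \<forall>e>0. \<exists>y. finitely_supported y \<and>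
                         schreier_norm (\<lambda>n. x n - y n) < ereal e}"

definition quotient_of_schreier :: "((nat \<Rightarrow> real) \<Rightarrow> 'a::real_normed_vector) \<Rightarrow> bool" where
  "quotient_of_schreier T \<longleftrightarrow>
     (\<forall>x\<in>schreier_space. \<forall>y\<in>schreier_space. \<forall>a b.
        T (\<lambda>n. a * x n + b * y n) = a *\<^sub>R T x + b *\<^sub>R T y) \<and>
     (\<exists>C. \<forall>x\<in>schreier_space. ereal (norm (T x)) \<le> ereal C * schreier_norm x) \<and>
     T ` schreier_space = UNIV"

definition c0_space :: "(nat \<Rightarrow> real) set" where
  "c0_space = {x. x \<longlonglongrightarrow> 0}"

definition sup_norm :: "(nat \<Rightarrow> real) \<Rightarrow> real" where
  "sup_norm x = (SUP n. \<bar>x n\<bar>)"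

definition contains_c0 :: "'a::real_normed_vector set \<Rightarrow> bool" where
  "contains_c0 Z \<longleftrightarrow> (\<exists>J :: (nat \<Rightarrow> real) \<Rightarrow> 'a.
     (\<forall>x\<in>c0_space. \<forall>y\<in>c0_space. \<forall>a b.
        J (\<lambda>n. a * x n + b * y n) = a *\<^sub>R J x + b *\<^sub>R J y) \<and>
     J ` c0_space \<subseteq> Z \<and>
     (\<exists>A B. 0 < A \<and> 0 < B \<and>
        (\<forall>x\<in>c0_space. A * sup_norm x \<le> norm (J x) \<and> norm (J x) \<le> B * sup_norm x)))"

definition infinite_dimensional :: "'a::real_vector set \<Rightarrow> bool" where
  "infinite_dimensional Z \<longleftrightarrow> \<not> (\<exists>B. finite B \<and> span B = Z)"

definition c0_saturated :: "'a::real_normed_vector set \<Rightarrow> bool" where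
  "c0_saturated Y \<longleftrightarrow> (\<forall>Z. Z \<subseteq> Y \<and> subspace Z \<and> closed Z \<and> infinite_dimensional Z
                          \<longrightarrow> contains_c0 Z)"

end

theory Submission
  imports Defs
begin

text \<open>
  Only the first half of the open mapping theorem is needed: every vector of \<open>Y\<close> has approximate
  lifts of controlled norm in \<open>c\<^sub>0\<^sub>0\<close>. Differences of lifts of a separated sequence in a subspace
  \<open>Z\<close> yield seminormalized vectors \<open>y k\<close> of \<open>Z\<close> with bounded lifts \<open>u k\<close> that are successive
  blocks of the unit vector basis. A Mazur-type selection makes the \<open>y k\<close> basic, and after thinning
  out, every bounded lift of \<open>w = \<Sum>\<^sub>k c\<^sub>k y\<^sub>k\<close> can be cut into successive pieces that lift the
  summands \<open>c\<^sub>k y\<^sub>k\<close>. The cuts are gradual: in a space as close to \<open>c\<^sub>0\<close> as the Schreier space a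
  bounded vector need not have small pieces at which to cut sharply, but bounded block sequences have
  convex combinations tending to \<open>0\<close>.

  A vector of bounded Schreier norm has boundedly many coordinates exceeding a given threshold. Hence,
  if all \<open>c\<^sub>k\<close> are small, replacing the few pieces that have a large coordinate by \<open>c\<^sub>k u\<^sub>k\<close> gives a
  bounded lift of \<open>w\<close> with small coordinates. Either the \<open>y k\<close> satisfy an upper \<open>c\<^sub>0\<close>-estimate, or
  there are normalized blocks with ever smaller coefficients; their lifts have rapidly decreasing
  coordinates and so satisfy an upper \<open>c\<^sub>0\<close>-estimate in the Schreier norm.
\<close>

subsection \<open>Combinatorics of the Schreier norm\<close>

text \<open>The obstacle is that a bounded lift of \<open>w\<close>, cut sharply at a position
  \<open>k\<close>, does not lift a partial sum of \<open>w\<close>; it misses it by some vector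
  \<open>d\<close>. If the \<open>y k\<close> were basic in the norm alone, \<open>d\<close> would
  merely be bounded, its lifts could live anywhere, and averaging over many cuts would gain nothing.
  The Mazur selection is therefore made for the norm and for the equivalent norms
  \<open>tail_gauge m\<close>, all \<open>m\<close>, at once: basicness in
  \<open>tail_gauge k\<close> says that \<open>d\<close> has, up to a small error, a bounded lift
  that starts at \<open>k\<close>. Compactness bounds the end of that lift independently of the
  vector being cut. Hence cut positions can be fixed beforehand so that the lifts of the errors are
  successive blocks, and suitable weights, also fixed beforehand, make the averaged error small. The
  averaged cut is thus one multiplier that works for all bounded lifts, and differences of
  consecutive multipliers are nonnegative with sum at most 1, so that dropping pieces does not
  increase the norm.\<close>

definition schreier_le :: "(nat \<Rightarrow> real) \<Rightarrow> real \<Rightarrow> bool" where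
  "schreier_le x s \<longleftrightarrow> (\<forall>F. schreier_admissible F \<longrightarrow> (\<Sum>k\<in>F. \<bar>x k\<bar>) \<le> s)"

lemma schreier_leI: "(\<And>F. schreier_admissible F \<Longrightarrow> (\<Sum>k\<in>F. \<bar>x k\<bar>) \<le> s) \<Longrightarrow> schreier_le x s"
  by (simp add: schreier_le_def)

lemma schreier_leD: "schreier_le x s \<Longrightarrow> schreier_admissible F \<Longrightarrow> (\<Sum>k\<in>F. \<bar>x k\<bar>) \<le> s"
  by (simp add: schreier_le_def)

text \<open>Only upper bounds of the norm are ever used. The real-valued predicate avoids extended
  reals, and this is its link to \<open>schreier_norm\<close>.\<close>

lemma schreier_le_iff: "schreier_le x s \<longleftrightarrow> schreier_norm x \<le> ereal s"
  by (auto simp: schreier_le_def schreier_norm_def SUP_le_iff)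

lemma schreier_admissible_singleton: "schreier_admissible {n}"
  by (simp add: schreier_admissible_def)

lemma schreier_le_abs: "schreier_le x s \<Longrightarrow> \<bar>x n\<bar> \<le> s"
  using schreier_leD[OF _ schreier_admissible_singleton, of x s n] by simp

lemma schreier_le_nonneg: "schreier_le x s \<Longrightarrow> 0 \<le> s"
  using schreier_le_abs[of x s 0] by linarith

lemma schreier_le_zero: "0 \<le> s \<Longrightarrow> schreier_le (\<lambda>n. 0) s"
  by (simp add: schreier_le_def)

lemma schreier_le_dominated:
  assumes "schreier_le x s" "\<And>n. \<bar>y n\<bar> \<le> \<bar>x n\<bar>" "s \<le> s'"
  shows "schreier_le y s'"
proof (rule schreier_leI)
  fix F assume "schreier_admissible F"
  then have "(\<Sum>k\<in>F. \<bar>x k\<bar>) \<le> s" using assms(1) schreier_leD by blast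
  moreover have "(\<Sum>k\<in>F. \<bar>y k\<bar>) \<le> (\<Sum>k\<in>F. \<bar>x k\<bar>)" by (rule sum_mono) (rule assms(2))
  ultimately show "(\<Sum>k\<in>F. \<bar>y k\<bar>) \<le> s'" using assms(3) by linarith
qed

lemma schreier_le_mono: "schreier_le x s \<Longrightarrow> s \<le> s' \<Longrightarrow> schreier_le x s'"
  by (rule schreier_le_dominated) auto

lemma schreier_le_add:
  assumes "schreier_le x s" "schreier_le y t"
  shows "schreier_le (\<lambda>n. x n + y n) (s + t)"
proof (rule schreier_leI)
  fix F assume F: "schreier_admissible F"
  have "(\<Sum>k\<in>F. \<bar>x k + y k\<bar>) \<le> (\<Sum>k\<in>F. \<bar>x k\<bar> + \<bar>y k\<bar>)" by (rule sum_mono) (rule abs_triangle_ineq)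
  also have "\<dots> \<le> s + t"
    using schreier_leD[OF assms(1) F] schreier_leD[OF assms(2) F] by (simp add: sum.distrib)
  finally show "(\<Sum>k\<in>F. \<bar>x k + y k\<bar>) \<le> s + t" .
qed

lemma schreier_le_cmult:
  assumes "schreier_le x s"
  shows "schreier_le (\<lambda>n. a * x n) (\<bar>a\<bar> * s)"
proof (rule schreier_leI)
  fix F assume F: "schreier_admissible F"
  then show "(\<Sum>k\<in>F. \<bar>a * x k\<bar>) \<le> \<bar>a\<bar> * s"
    using schreier_leD[OF assms F] by (simp add: abs_mult sum_distrib_left[symmetric] mult_left_mono)
qed

lemma schreier_le_diff:
  assumes "schreier_le x s" "schreier_le y t"
  shows "schreier_le (\<lambda>n. x n - y n) (s + t)"
  using schreier_le_add[OF assms(1) schreier_le_cmult[OF assms(2), of "-1"]] by simp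

lemma schreier_le_sum:
  assumes "\<And>i. i \<in> I \<Longrightarrow> schreier_le (x i) (s i)"
  shows "schreier_le (\<lambda>n. \<Sum>i\<in>I. x i n) (\<Sum>i\<in>I. s i)"
  using assms
  by (induction I rule: infinite_finite_induct) (auto intro: schreier_le_zero schreier_le_add)

text \<open>An admissible set that starts in the block \<open>[k i, k (Suc i))\<close> has at most \<open>k (Suc i)\<close>
  elements, so it sees the block \<open>t i\<close> fully but only a negligible part of the later blocks.\<close>

lemma schreier_le_sum_blocks:
  fixes t :: "nat \<Rightarrow> nat \<Rightarrow> real"
  assumes k: "mono k"
    and lo: "\<And>j n. j < m \<Longrightarrow> n < k j \<Longrightarrow> t j n = 0"
    and hi: "\<And>j n. j < m \<Longrightarrow> k (Suc j) \<le> n \<Longrightarrow> t j n = 0"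
    and R: "\<And>j. j < m \<Longrightarrow> schreier_le (t j) R" "0 \<le> R"
    and small: "\<And>j n. j < m \<Longrightarrow> \<bar>t j n\<bar> * k j \<le> (1/2)^j"
  shows "schreier_le (\<lambda>n. \<Sum>j<m. t j n) (R + 2)"
proof (rule schreier_leI)
  fix F assume F: "schreier_admissible F"
  \<comment> \<open>The block in which \<open>F\<close> starts. If there is none, \<open>i\<close>
    is arbitrary, but then every \<open>j\<close> falls under the first case below.\<close>
  define i where "i = (LEAST j. Min F < k (Suc j))"
  have fin: "finite F" and cF: "card F \<le> Min F + 1" and ge: "\<And>n. n \<in> F \<Longrightarrow> Min F \<le> n"
    using F by (auto simp: schreier_admissible_def)
  have each: "(\<Sum>n\<in>F. \<bar>t j n\<bar>) \<le> (if j = i then R else 0) + (1/2)^j" if j: "j < m" for j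
  proof -
    consider "k (Suc j) \<le> Min F" | "Min F < k (Suc j)" "j = i" | "Min F < k (Suc j)" "i < j"
      using Least_le[of "\<lambda>j. Min F < k (Suc j)" j] unfolding i_def by fastforce
    then show ?thesis
    proof cases
      case 1
      then have "t j n = 0" if "n \<in> F" for n using hi[OF j] ge[OF that] by simp
      then have "(\<Sum>n\<in>F. \<bar>t j n\<bar>) = 0" by simp
      then show ?thesis using R(2) by simp
    next
      case 2
      then show ?thesis using schreier_leD[OF R(1)[OF j] F] by (simp add: add_increasing2)
    next
      case 3
      have "Min F < k (Suc i)" using LeastI[of "\<lambda>j. Min F < k (Suc j)" j] 3 unfolding i_def by blast
      also have "k (Suc i) \<le> k j" using k 3(2) by (simp add: monoD)
      \<comment> \<open>The strict inequality for \<open>Min F\<close> absorbs the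
        \<open>+ 1\<close> of admissibility.\<close>
      finally have card: "card F \<le> k j" using cF by linarith
      have "(\<Sum>n\<in>F. \<bar>t j n\<bar>) \<le> (1/2)^j"
      proof (cases "F = {}")
        case False
        then have "k j > 0" using card fin by (metis card_gt_0_iff less_le_trans)
        have "(\<Sum>n\<in>F. \<bar>t j n\<bar>) \<le> (\<Sum>n\<in>F. (1/2)^j / k j)"
          by (rule sum_mono) (use small[OF j] \<open>k j > 0\<close> in \<open>simp add: pos_le_divide_eq\<close>)
        also have "\<dots> = card F * ((1/2)^j / k j)" by simp
        also have "\<dots> \<le> k j * ((1/2)^j / k j)"
          by (rule mult_right_mono) (use card in auto)
        also have "\<dots> = (1/2)^j" using \<open>k j > 0\<close> by simp
        finally show ?thesis .
      qed simp
      then show ?thesis using 3(2) by simp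
    qed
  qed
  have "(\<Sum>n\<in>F. \<bar>\<Sum>j<m. t j n\<bar>) \<le> (\<Sum>n\<in>F. \<Sum>j<m. \<bar>t j n\<bar>)"
    by (rule sum_mono) (rule sum_abs)
  also have "\<dots> = (\<Sum>j<m. \<Sum>n\<in>F. \<bar>t j n\<bar>)" by (rule sum.swap)
  also have "\<dots> \<le> (\<Sum>j<m. (if j = i then R else 0) + (1/2)^j)" by (rule sum_mono) (use each in auto)
  also have "\<dots> = (\<Sum>j<m. if j = i then R else 0) + (\<Sum>j<m. (1/2)^j)" by (rule sum.distrib)
  also have "(\<Sum>j<m. if j = i then R else 0) \<le> R" using R(2) by (simp add: sum.delta)
  also have "(\<Sum>j<m. (1/2::real)^j) \<le> 2"
    by (simp add: sum_gp_strict)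
  finally show "(\<Sum>n\<in>F. \<bar>\<Sum>j<m. t j n\<bar>) \<le> R + 2" by simp
qed

text \<open>The weights average \<open>q\<close> consecutive averages, the \<open>i\<close>-th of which is so long that its
  coordinates are negligible against the position where it starts.\<close>

lemma schreier_convex_weights:
  fixes k :: "nat \<Rightarrow> nat" and R \<epsilon> :: real
  assumes k: "strict_mono k" and R: "0 \<le> R" and eps: "0 < \<epsilon>"
  obtains m :: nat and c :: "nat \<Rightarrow> real" where "\<And>j. 0 \<le> c j" "(\<Sum>j<m. c j) = 1"
    "\<And>t. (\<And>j n. n < k j \<or> k (Suc j) \<le> n \<Longrightarrow> t j n = 0) \<Longrightarrow> (\<And>j. schreier_le (t j) R)
      \<Longrightarrow> schreier_le (\<lambda>n. \<Sum>j<m. c j * t j n) \<epsilon>"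
proof -
  \<comment> \<open>The length \<open>2^i * R * k a\<close> of the next average makes its
    coordinates, at most \<open>R\<close> divided by the length, small enough for
    \<open>schreier_le_sum_blocks\<close>; \<open>+ 1\<close> keeps the length positive.\<close>
  define step where "step = (\<lambda>i a::nat. a + nat \<lceil>2^i * R * k a\<rceil> + 1)"
  define a where "a = rec_nat 0 step"
  have a0: "a 0 = 0" and aS: "\<And>i. a (Suc i) = step i (a i)" by (simp_all add: a_def)
  have a_less: "a i < a (Suc i)" for i by (simp add: aS step_def)
  then have a_sm: "strict_mono a" by (simp add: strict_mono_Suc_iff)
  define s where "s i = real (a (Suc i) - a i)" for i
  have s_pos: "s i > 0" for i using a_less[of i] by (simp add: s_def)
  have s_ge: "2^i * R * k (a i) \<le> s i" for i
    unfolding s_def aS step_def by simp linarith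
  \<comment> \<open>The sum of all \<open>q\<close> averages will be bounded by
    \<open>R + 2\<close>, whatever \<open>q\<close> is.\<close>
  obtain q :: nat where q: "(R + 2) / \<epsilon> < q" using reals_Archimedean2 by blast
  then have q_pos: "q > 0" using R eps by (metis add_nonneg_pos divide_pos_pos gr0I less_trans of_nat_0 order_less_irrefl zero_less_numeral)
  define w where "w i j = (if a i \<le> j \<and> j < a (Suc i) then 1 / s i else 0)" for i j
  define c where "c j = (\<Sum>i<q. w i j) / q" for j
  have w_nonneg: "0 \<le> w i j" for i j using s_pos[of i] by (simp add: w_def)
  have w_sum: "(\<Sum>j<a q. w i j * f j) = (\<Sum>j=a i..<a (Suc i). f j) / s i" if "i < q" for i f
  proof -
    have sub: "{a i..<a (Suc i)} \<subseteq> {..<a q}"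
      using that strict_mono_less_eq[OF a_sm, of "Suc i" q] by auto
    have "(\<Sum>j<a q. w i j * f j) = (\<Sum>j\<in>{a i..<a (Suc i)}. w i j * f j)"
      by (rule sum.mono_neutral_right) (use sub in \<open>auto simp: w_def\<close>)
    also have "\<dots> = (\<Sum>j=a i..<a (Suc i). f j / s i)"
      by (rule sum.cong) (auto simp: w_def)
    finally show ?thesis by (simp add: sum_divide_distrib)
  qed
  show thesis
  proof
    show "0 \<le> c j" for j by (simp add: c_def w_nonneg sum_nonneg)
    have "(\<Sum>j<a q. c j) = (\<Sum>i<q. \<Sum>j<a q. w i j) / q"
      unfolding c_def sum_divide_distrib[symmetric] by (simp add: sum.swap[of _ "{..<a q}"])
    also have "(\<Sum>i<q. \<Sum>j<a q. w i j) = (\<Sum>i<q. 1)"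
    proof (rule sum.cong)
      fix i assume "i \<in> {..<q}"
      then show "(\<Sum>j<a q. w i j) = 1"
        using w_sum[of i "\<lambda>_. 1"] s_pos[of i] by (simp add: s_def)
    qed simp
    finally show "(\<Sum>j<a q. c j) = 1" using q_pos by simp
  next
    fix t :: "nat \<Rightarrow> nat \<Rightarrow> real"
    assume supp: "\<And>j n. n < k j \<or> k (Suc j) \<le> n \<Longrightarrow> t j n = 0" and t: "\<And>j. schreier_le (t j) R"
    define u where "u i n = (\<Sum>j=a i..<a (Suc i). t j n) / s i" for i n
    have k_mono: "k i \<le> k j" if "i \<le> j" for i j using k that by (simp add: strict_mono_less_eq)
    have "schreier_le (\<lambda>n. \<Sum>i<q. u i n) (R + 2)"
    proof (rule schreier_le_sum_blocks[where k = "\<lambda>i. k (a i)"])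
      show "mono (\<lambda>i. k (a i))"
        using a_sm k_mono by (auto intro!: monoI simp: strict_mono_less_eq)
    next
      fix i n assume n: "n < k (a i)"
      have "t j n = 0" if "j \<in> {a i..<a (Suc i)}" for j
        using that n k_mono[of "a i" j] by (intro supp disjI1) auto
      then show "u i n = 0" by (simp add: u_def)
    next
      fix i n assume n: "k (a (Suc i)) \<le> n"
      have "t j n = 0" if "j \<in> {a i..<a (Suc i)}" for j
        using that n k_mono[of "Suc j" "a (Suc i)"] by (intro supp disjI2) auto
      then show "u i n = 0" by (simp add: u_def)
    next
      fix i
      have "schreier_le (\<lambda>n. (1 / s i) * (\<Sum>j=a i..<a (Suc i). t j n)) (\<bar>1 / s i\<bar> * (\<Sum>j=a i..<a (Suc i). R))"
        by (intro schreier_le_cmult schreier_le_sum t)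
      then show "schreier_le (u i) R"
        using s_pos[of i] unfolding u_def by (simp add: s_def)
    next
      fix i n
      \<comment> \<open>The supports are disjoint, so at most one summand is nonzero at
        \<open>n\<close>.\<close>
      have "\<bar>\<Sum>j=a i..<a (Suc i). t j n\<bar> \<le> R"
      proof (cases "\<exists>j\<in>{a i..<a (Suc i)}. t j n \<noteq> 0")
        case True
        then obtain j where j: "j \<in> {a i..<a (Suc i)}" "t j n \<noteq> 0" by blast
        then have "k j \<le> n" "n < k (Suc j)" using supp[of n j] by force+
        then have "t j' n = 0" if "j' \<noteq> j" for j'
        proof (cases "j' < j")
          case True
          then show ?thesis using k_mono[of "Suc j'" j] \<open>k j \<le> n\<close> by (intro supp) auto
        next
          case False
          then show ?thesis using k_mono[of "Suc j" j'] \<open>n < k (Suc j)\<close> that by (intro supp) auto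
        qed
        then have "(\<Sum>j=a i..<a (Suc i). t j n) = t j n"
          using sum.remove[OF _ j(1), of "\<lambda>j. t j n"] by simp
        then show ?thesis using schreier_le_abs[OF t] by simp
      next
        case False
        then have "(\<Sum>j=a i..<a (Suc i). t j n) = 0" by (intro sum.neutral) auto
        then show ?thesis using R by simp
      qed
      then have "\<bar>u i n\<bar> * k (a i) \<le> (R / s i) * k (a i)"
        using s_pos[of i] by (intro mult_right_mono) (auto simp: u_def abs_divide divide_right_mono)
      also have "\<dots> \<le> (1/2)^i"
        using s_ge[of i] s_pos[of i] by (simp add: field_simps power_divide)
      finally show "\<bar>u i n\<bar> * k (a i) \<le> (1/2)^i" .
    qed (use R in auto)
    then have "schreier_le (\<lambda>n. (1/q) * (\<Sum>i<q. u i n)) (\<bar>1/q\<bar> * (R + 2))"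
      by (rule schreier_le_cmult)
    moreover have "(1/q) * (\<Sum>i<q. u i n) = (\<Sum>j<a q. c j * t j n)" for n
    proof -
      have "(\<Sum>j<a q. c j * t j n) = (\<Sum>j<a q. \<Sum>i<q. w i j * t j n) / q"
        by (simp add: c_def sum_divide_distrib sum_distrib_right)
      also have "(\<Sum>j<a q. \<Sum>i<q. w i j * t j n) = (\<Sum>i<q. \<Sum>j<a q. w i j * t j n)" by (rule sum.swap)
      also have "\<dots> = (\<Sum>i<q. u i n)" by (rule sum.cong) (auto simp: w_sum u_def)
      finally show ?thesis by simp
    qed
    moreover have "\<bar>1/q\<bar> * (R + 2) \<le> \<epsilon>"
      using q q_pos eps by (simp add: field_simps)
    ultimately show "schreier_le (\<lambda>n. \<Sum>j<a q. c j * t j n) \<epsilon>"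
      by (auto elim: schreier_le_mono)
  qed
qed

text \<open>The larger half of a finite set of natural numbers is admissible.\<close>

lemma schreier_le_card_large:
  assumes "schreier_le x s" "0 < \<eta>" "finite F" "\<And>n. n \<in> F \<Longrightarrow> \<eta> < \<bar>x n\<bar>"
  shows "card F \<le> 2 * s / \<eta>"
proof (cases "F = {}")
  case True
  then show ?thesis using schreier_le_nonneg[OF assms(1)] assms(2) by simp
next
  case False
  define f where "f = card F"
  have "f > 0" using False assms(3) by (simp add: f_def card_gt_0_iff)
  \<comment> \<open>At most \<open>f div 2\<close> elements lie below \<open>f div 2\<close>, so
    \<open>f - f div 2\<close> elements can be chosen above it; this number is at most
    \<open>f div 2 + 1\<close>, hence the choice is admissible.\<close>
  have "F \<subseteq> {n\<in>F. f div 2 \<le> n} \<union> {..<f div 2}" by auto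
  then have "f \<le> card ({n\<in>F. f div 2 \<le> n} \<union> {..<f div 2})"
    unfolding f_def by (rule card_mono[rotated]) (use assms(3) in auto)
  also have "\<dots> \<le> card {n\<in>F. f div 2 \<le> n} + f div 2"
    using card_Un_le[of "{n\<in>F. f div 2 \<le> n}" "{..<f div 2}"] by simp
  finally have "f - f div 2 \<le> card {n\<in>F. f div 2 \<le> n}" by linarith
  then obtain G where G: "G \<subseteq> {n\<in>F. f div 2 \<le> n}" "card G = f - f div 2" "finite G"
    by (rule obtain_subset_with_card_n)
  then have "G \<noteq> {}" using \<open>f > 0\<close> by auto
  then have "f div 2 \<le> Min G" using G by auto
  then have "schreier_admissible G"
    unfolding schreier_admissible_def using G(2,3) \<open>G \<noteq> {}\<close> by linarith
  then have "(\<Sum>k\<in>G. \<bar>x k\<bar>) \<le> s" using assms(1) schreier_leD by blast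
  moreover have "(\<Sum>k\<in>G. \<eta>) \<le> (\<Sum>k\<in>G. \<bar>x k\<bar>)"
    by (rule sum_mono) (use assms(4) G in \<open>auto intro: less_imp_le\<close>)
  ultimately have "real (card G) * \<eta> \<le> s" by simp
  moreover have "real f \<le> 2 * real (card G)" using G(2) by linarith
  ultimately have "real f * \<eta> \<le> 2 * s"
    using order_trans[OF mult_right_mono[of "real f" "2 * real (card G)" \<eta>], of "2 * s"] assms(2)
    by (simp add: mult.assoc)
  then show ?thesis using assms(2) by (simp add: f_def pos_le_divide_eq)
qed

subsection \<open>Finite-dimensional subspaces\<close>

lemma closed_if_compact_Int_cball:
  fixes S :: "'a::real_normed_vector set"
  assumes "\<And>R. compact (S \<inter> cball 0 R)"
  shows "closed S"
proof (rule closed_sequential_limits[THEN iffD2], intro allI impI, elim conjE)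
  fix f l assume f: "\<forall>n. f n \<in> S" "f \<longlonglongrightarrow> l"
  have "Bseq f" by (intro convergent_imp_Bseq convergentI[OF f(2)])
  then obtain r where "\<And>n. norm (f n) \<le> r" unfolding Bseq_def by blast
  then have "f n \<in> S \<inter> cball 0 r" for n using f by simp
  then show "l \<in> S"
    using closed_sequentially[OF compact_imp_closed[OF assms[of r]] _ f(2)] by blast
qed

text \<open>The smaller span is closed by induction, so a new vector \<open>b\<close> has positive
  distance from it. This bounds the coefficient of \<open>b\<close>, and the slice is a closed part
  of a continuous image of a compact product.\<close>

lemma compact_span_cball:
  fixes B :: "'a::real_normed_vector set"
  assumes "finite B"
  shows "compact (span B \<inter> cball 0 R)"
  using assms
proof (induction B arbitrary: R rule: finite_induct)
  case empty
  show ?case by (rule finite_imp_compact) simp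
next
  case (insert b B)
  show ?case
  proof (cases "b \<in> span B")
    case True
    then show ?thesis using insert.IH by (simp add: span_redundant)
  next
    case False
    have closed: "closed (span B)" using insert.IH by (rule closed_if_compact_Int_cball)
    define \<delta> where "\<delta> = infdist b (span B)"
    have "\<delta> > 0"
      unfolding \<delta>_def using False span_zero[of B]
      by (intro infdist_pos_not_in_closed[OF closed]) auto
    have coeff: "\<bar>a\<bar> * \<delta> \<le> norm (v + a *\<^sub>R b)" if "v \<in> span B" for a v
    proof (cases "a = 0")
      case False
      have "- (1/a) *\<^sub>R v \<in> span B" using that by (rule span_scale)
      then have "\<delta> \<le> dist b (- (1/a) *\<^sub>R v)" unfolding \<delta>_def by (rule infdist_le)
      also have "\<dots> = norm ((1/a) *\<^sub>R (v + a *\<^sub>R b))"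
        using False by (simp add: dist_norm scaleR_add_right add.commute)
      finally have "\<delta> \<le> norm (v + a *\<^sub>R b) / \<bar>a\<bar>" by simp
      then show ?thesis using False by (simp add: field_simps)
    qed simp
    \<comment> \<open>The bound that \<open>coeff\<close> gives for the coefficient of
      \<open>b\<close>; the absolute value covers negative radii.\<close>
    define r where "r = \<bar>R\<bar> / \<delta>"
    define S where "S = (\<lambda>(v, a). v + a *\<^sub>R b) ` ((span B \<inter> cball 0 (\<bar>R\<bar> + r * norm b)) \<times> {-r..r})"
    have "compact S"
      unfolding S_def
      by (intro compact_continuous_image compact_Times insert.IH compact_Icc)
        (simp add: case_prod_unfold, intro continuous_intros)
    moreover have "span (insert b B) \<inter> cball 0 R = S \<inter> cball 0 R"
    proof (intro equalityI subsetI)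
      fix y assume y: "y \<in> span (insert b B) \<inter> cball 0 R"
      have ny: "norm y \<le> \<bar>R\<bar>" using IntD2[OF y] by simp
      obtain a where a: "y - a *\<^sub>R b \<in> span B" using IntD1[OF y] unfolding span_insert by blast
      have "\<bar>a\<bar> * \<delta> \<le> norm y" using coeff[OF a, of a] by simp
      then have "\<bar>a\<bar> * \<delta> \<le> \<bar>R\<bar>" using ny by linarith
      then have ar: "\<bar>a\<bar> \<le> r" unfolding r_def using \<open>\<delta> > 0\<close> by (simp add: pos_le_divide_eq)
      have "norm (y - a *\<^sub>R b) \<le> norm y + \<bar>a\<bar> * norm b"
        using norm_triangle_ineq4[of y "a *\<^sub>R b"] by simp
      also have "\<dots> \<le> \<bar>R\<bar> + r * norm b"
        using ny ar by (intro add_mono mult_right_mono) simp_all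
      finally have "y - a *\<^sub>R b \<in> span B \<inter> cball 0 (\<bar>R\<bar> + r * norm b)" using a by simp
      then have "y \<in> S" unfolding S_def using ar by (intro image_eqI[of _ _ "(y - a *\<^sub>R b, a)"]) auto
      then show "y \<in> S \<inter> cball 0 R" using y by blast
    next
      fix y assume y: "y \<in> S \<inter> cball 0 R"
      then obtain v a where "v \<in> span B" "y = v + a *\<^sub>R b" unfolding S_def by auto
      then have "y \<in> span (insert b B)"
        using span_mono[OF subset_insertI] by (blast intro: span_add span_scale span_base)
      then show "y \<in> span (insert b B) \<inter> cball 0 R" using y by blast
    qed
    ultimately show ?thesis by (metis compact_Int_closed closed_cball)
  qed
qed

lemma closed_span_finite:
  fixes B :: "'a::real_normed_vector set"
  shows "finite B \<Longrightarrow> closed (span B)"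
  by (intro closed_if_compact_Int_cball compact_span_cball)

subsection \<open>Approximate lifts\<close>

definition restr :: "nat set \<Rightarrow> (nat \<Rightarrow> real) \<Rightarrow> nat \<Rightarrow> real" where
  "restr A x n = (if n \<in> A then x n else 0)"

text \<open>When \<open>e n\<close> is the image of the \<open>n\<close>-th unit vector under the
  quotient map, this is the image of \<open>x\<close> restricted to \<open>A\<close>.\<close>

definition lincomb :: "(nat \<Rightarrow> 'a::real_vector) \<Rightarrow> nat set \<Rightarrow> (nat \<Rightarrow> real) \<Rightarrow> 'a" where
  "lincomb e A x = (\<Sum>n\<in>A. x n *\<^sub>R e n)"

lemma schreier_le_restr: "schreier_le x s \<Longrightarrow> schreier_le (restr A x) s"
  by (rule schreier_le_dominated) (auto simp: restr_def)

lemma lincomb_restr: "finite B \<Longrightarrow> lincomb e B (restr A x) = lincomb e (A \<inter> B) x"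
  unfolding lincomb_def restr_def
  by (rule sum.mono_neutral_cong_right) auto

lemma lincomb_restr_subset: "finite B \<Longrightarrow> A \<subseteq> B \<Longrightarrow> lincomb e B (restr A x) = lincomb e A x"
  by (simp add: lincomb_restr Int_absorb2)

lemma lincomb_add: "lincomb e A (\<lambda>n. x n + y n) = lincomb e A x + lincomb e A y"
  by (simp add: lincomb_def scaleR_add_left sum.distrib)

lemma lincomb_diff: "lincomb e A (\<lambda>n. x n - y n) = lincomb e A x - lincomb e A y"
  by (simp add: lincomb_def scaleR_diff_left sum_subtractf)

lemma lincomb_cmult: "lincomb e A (\<lambda>n. a * x n) = a *\<^sub>R lincomb e A x"
  by (simp add: lincomb_def scaleR_sum_right)

lemma lincomb_sum: "lincomb e A (\<lambda>n. \<Sum>i\<in>I. x i n) = (\<Sum>i\<in>I. lincomb e A (x i))"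
  unfolding lincomb_def scaleR_sum_left by (rule sum.swap)

lemma lincomb_in_span: "lincomb e A x \<in> span (e ` A)"
  unfolding lincomb_def by (intro span_sum span_scale span_base) auto

lemma lincomb_mono_neutral:
  "finite B \<Longrightarrow> A \<subseteq> B \<Longrightarrow> (\<And>n. n \<in> B - A \<Longrightarrow> x n = 0) \<Longrightarrow> lincomb e B x = lincomb e A x"
  unfolding lincomb_def by (rule sum.mono_neutral_right) auto

lemma lincomb_split: "m \<le> M \<Longrightarrow> lincomb e {..<M} x = lincomb e {..<m} x + lincomb e {m..<M} x"
  unfolding lincomb_def lessThan_atLeast0 by (simp add: sum.atLeastLessThan_concat)

lemma schreier_norm_nonneg: "0 \<le> schreier_norm x"
  unfolding schreier_norm_def
  by (rule SUP_upper2[of "{0}"]) (auto simp: schreier_admissible_singleton)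

lemma finitely_supported_in_schreier_space: "finitely_supported x \<Longrightarrow> x \<in> schreier_space"
proof -
  assume x: "finitely_supported x"
  have "schreier_norm (\<lambda>n. x n - x n) < ereal r" if "0 < r" for r
    using schreier_le_zero[of 0] that
    by (simp add: schreier_le_iff) (metis ereal_less(2) le_less_trans zero_ereal_def)
  with x show ?thesis unfolding schreier_space_def by blast
qed

lemma finitely_supported_restr: "finite A \<Longrightarrow> finitely_supported (restr A x)"
  unfolding finitely_supported_def restr_def by (rule finite_subset[of _ A]) auto

lemma finitely_supported_eq_restr:
  assumes "finitely_supported x"
  obtains M where "x = restr {..<M} x"
proof -
  obtain M where "\<And>n. x n \<noteq> 0 \<Longrightarrow> n < M"
    using assms unfolding finitely_supported_def by (auto simp: finite_nat_iff_bounded)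
  then have "x = restr {..<M} x" unfolding restr_def by fastforce
  then show thesis by (rule that)
qed

text \<open>What is kept of the quotient map: the images \<open>e n\<close> of the unit vectors,
  boundedness, and approximate lifts. \<open>K\<close> does not depend on the accuracy, so no
  iteration towards exact lifts is required.\<close>

locale schreier_lifting =
  fixes e :: "nat \<Rightarrow> 'a::banach" and C K :: real
  assumes C_pos: "0 < C" and K_pos: "0 < K"
    and lincomb_bound: "finite A \<Longrightarrow> schreier_le x s \<Longrightarrow> norm (lincomb e A x) \<le> C * s"
    and lift: "0 < \<epsilon> \<Longrightarrow> \<exists>x M. schreier_le x (K * norm y) \<and> norm (y - lincomb e {..<M} x) < \<epsilon>"

section \<open>The open mapping argument for the quotient map\<close>

lemma Baire_UNIV:
  fixes A :: "nat \<Rightarrow> 'a::{complete_space, real_normed_vector} set"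
  assumes "\<And>n. closed (A n)" "(\<Union>n. A n) = UNIV"
  obtains n y r where "0 < r" "ball y r \<subseteq> A n"
proof -
  have "\<exists>n. interior (A n) \<noteq> {}"
  proof (rule ccontr)
    assume "\<not> ?thesis"
    then have "euclidean interior_of (\<Union>(range A)) = {}"
      using assms(1)
      by (intro Baire_category_alt disjI1 completely_metrizable_space_euclidean)
        (auto simp: interior_of_def interior_def)
    then show False using assms(2) by simp
  qed
  then obtain n y where "y \<in> interior (A n)" by blast
  then show thesis using that by (auto simp: mem_interior)
qed

text \<open>Finitely supported sequences are dense, so the closures of the images \<open>L n\<close>
  of their balls cover the target. By Baire one closure contains a ball, which is then moved to the
  origin and rescaled.\<close>

lemma schreier_lifting_if_quotient:
  fixes T :: "(nat \<Rightarrow> real) \<Rightarrow> 'a::banach"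
  assumes "quotient_of_schreier T"
  obtains e C K where "schreier_lifting (e :: nat \<Rightarrow> 'a) C K"
proof -
  obtain C0 where lin: "\<And>x y a b. x \<in> schreier_space \<Longrightarrow> y \<in> schreier_space \<Longrightarrow>
        T (\<lambda>n. a * x n + b * y n) = a *\<^sub>R T x + b *\<^sub>R T y"
    and C0: "\<And>x. x \<in> schreier_space \<Longrightarrow> ereal (norm (T x)) \<le> ereal C0 * schreier_norm x"
    and surj: "T ` schreier_space = UNIV"
    using assms unfolding quotient_of_schreier_def by blast
  \<comment> \<open>\<open>C0\<close> may be zero or negative, while the locale asks for a positive
    bound.\<close>
  define C where "C = max C0 1"
  have "0 \<le> C" by (simp add: C_def)
  have C: "norm (T x) \<le> C * s" if "x \<in> schreier_space" "schreier_le x s" for x s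
  proof -
    have "ereal (norm (T x)) \<le> ereal C0 * schreier_norm x" using C0 that by blast
    also have "\<dots> \<le> ereal C * schreier_norm x"
      by (intro ereal_mult_right_mono schreier_norm_nonneg) (simp add: C_def)
    also have "\<dots> \<le> ereal C * ereal s"
      by (intro ereal_mult_left_mono) (use that \<open>0 \<le> C\<close> in \<open>auto simp: schreier_le_iff\<close>)
    finally show ?thesis by simp
  qed
  define e where "e n = T (restr {n} (\<lambda>_. 1))" for n
  have fin: "restr A x \<in> schreier_space" if "finite A" for A x
    using that by (intro finitely_supported_in_schreier_space finitely_supported_restr)
  have T_restr: "T (restr A x) = lincomb e A x" if "finite A" for A x
    using that
  proof (induction A rule: finite_induct)
    case empty
    have "restr {} x = (\<lambda>n. 0 * restr {} x n + 0 * restr {} x n)" by (simp add: restr_def fun_eq_iff)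
    then have "T (restr {} x) = 0 *\<^sub>R T (restr {} x) + 0 *\<^sub>R T (restr {} x)"
      using lin[OF fin[of "{}" x] fin[of "{}" x], of 0 0] by simp
    then show ?case by (simp add: lincomb_def)
  next
    case (insert a A)
    have "restr (insert a A) x = (\<lambda>n. 1 * restr A x n + x a * restr {a} (\<lambda>_. 1) n)"
      using insert.hyps by (auto simp: restr_def fun_eq_iff)
    then have "T (restr (insert a A) x) = 1 *\<^sub>R T (restr A x) + x a *\<^sub>R T (restr {a} (\<lambda>_. 1))"
      using lin[of "restr A x" "restr {a} (\<lambda>_. 1)" 1 "x a"] fin insert.hyps(1) by simp
    then show ?case using insert by (simp add: lincomb_def e_def)
  qed
  define L where "L n = {lincomb e {..<M} x | x M. schreier_le x (real n)}" for n :: nat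
  have cover: "\<exists>n. y \<in> closure (L n)" for y
  proof -
    obtain x where x: "x \<in> schreier_space" "y = T x" using surj by (metis UNIV_I imageE)
    have approx: "\<exists>M z. schreier_le (\<lambda>n. x n - restr {..<M} z n) \<epsilon>" if "0 < \<epsilon>" for \<epsilon>
    proof -
      obtain z where z: "finitely_supported z" "schreier_norm (\<lambda>n. x n - z n) < ereal \<epsilon>"
        using x(1) \<open>0 < \<epsilon>\<close> unfolding schreier_space_def by blast
      obtain M where "z = restr {..<M} z" using z(1) by (rule finitely_supported_eq_restr)
      then show ?thesis using z(2) by (metis less_imp_le schreier_le_iff)
    qed
    \<comment> \<open>Being at distance at most 1 from a finitely supported sequence,
      \<open>x\<close> has finite Schreier norm.\<close>
    obtain M0 z0 where z0: "schreier_le (\<lambda>n. x n - restr {..<M0} z0 n) 1" using approx[of 1] by auto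
    have "schreier_le (restr {..<M0} z0) (\<Sum>n<M0. \<bar>z0 n\<bar>)"
    proof (rule schreier_leI)
      fix F assume "schreier_admissible F"
      then have "finite F" by (simp add: schreier_admissible_def)
      then have "(\<Sum>n\<in>F. \<bar>restr {..<M0} z0 n\<bar>) = (\<Sum>n\<in>F \<inter> {..<M0}. \<bar>z0 n\<bar>)"
        by (intro sum.mono_neutral_cong_right) (auto simp: restr_def)
      also have "\<dots> \<le> (\<Sum>n<M0. \<bar>z0 n\<bar>)" by (rule sum_mono2) auto
      finally show "(\<Sum>n\<in>F. \<bar>restr {..<M0} z0 n\<bar>) \<le> (\<Sum>n<M0. \<bar>z0 n\<bar>)" .
    qed
    from schreier_le_add[OF z0 this] have "schreier_le x (1 + (\<Sum>n<M0. \<bar>z0 n\<bar>))" by simp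
    then obtain c where c: "schreier_le x c" by blast
    obtain N :: nat where N: "c + 1 \<le> real N" using real_arch_simple by blast
    have "y \<in> closure (L N)"
    proof (subst closure_approachable, intro allI impI)
      fix r :: real assume "0 < r"
      \<comment> \<open>\<open>\<epsilon> \<le> 1\<close> keeps the truncated approximation in the
        ball of radius \<open>N\<close>, and \<open>C * \<epsilon> < r\<close> brings its image
        close to \<open>y\<close>.\<close>
      define \<epsilon> where "\<epsilon> = min 1 (r / (2 * C))"
      have "0 < C" by (simp add: C_def)
      then have eps: "0 < \<epsilon>" "\<epsilon> \<le> 1" "C * \<epsilon> < r"
        using \<open>0 < r\<close> by (auto simp: \<epsilon>_def min_def field_simps)
      obtain M z where z: "schreier_le (\<lambda>n. x n - restr {..<M} z n) \<epsilon>" using approx eps by blast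
      have "schreier_le (\<lambda>n. x n - (x n - restr {..<M} z n)) (c + \<epsilon>)"
        by (rule schreier_le_diff[OF c z])
      then have "schreier_le (restr {..<M} z) (real N)"
        using N eps by (auto elim: schreier_le_mono)
      then have "lincomb e {..<M} (restr {..<M} z) \<in> L N" unfolding L_def by blast
      then have inL: "lincomb e {..<M} z \<in> L N" by (simp add: lincomb_restr_subset)
      have "(\<lambda>n. x n - restr {..<M} z n) \<in> schreier_space"
        unfolding schreier_space_def
      proof (intro CollectI allI impI)
        fix d :: real assume "0 < d"
        then obtain z' where z': "finitely_supported z'" "schreier_norm (\<lambda>n. x n - z' n) < ereal d"
          using x(1) unfolding schreier_space_def by blast
        have "finitely_supported (\<lambda>n. z' n - restr {..<M} z n)"
          unfolding finitely_supported_def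
          by (rule finite_subset[of _ "{n. z' n \<noteq> 0} \<union> {..<M}"])
            (use z'(1) in \<open>auto simp: finitely_supported_def restr_def split: if_splits\<close>)
        then show "\<exists>y. finitely_supported y \<and>
            schreier_norm (\<lambda>n. x n - restr {..<M} z n - y n) < ereal d"
          using z'(2) by (intro exI[of _ "\<lambda>n. z' n - restr {..<M} z n"]) simp
      qed
      then have "norm (T (\<lambda>n. x n - restr {..<M} z n)) \<le> C * \<epsilon>" using z by (rule C)
      also have "T (\<lambda>n. x n - restr {..<M} z n) = y - lincomb e {..<M} z"
        using lin[OF x(1) fin[of "{..<M}" z], of 1 "-1"] x(2) by (simp add: T_restr)
      finally show "\<exists>v\<in>L N. dist v y < r"
        using inL eps by (intro bexI[OF _ inL]) (simp add: dist_norm norm_minus_commute)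
    qed
    then show ?thesis by blast
  qed
  obtain N y0 r where r: "0 < r" "ball y0 r \<subseteq> closure (L N)"
    by (rule Baire_UNIV[of "\<lambda>n. closure (L n)"]) (use cover in auto)
  \<comment> \<open>Scaling a vector to norm \<open>r / 2\<close>, inside the ball, costs the factor
    \<open>2 / r\<close>; \<open>N + 1\<close> keeps \<open>K\<close> positive when
    \<open>N = 0\<close>.\<close>
  define K where "K = 2 * (real N + 1) / r"
  have "K > 0" using r by (simp add: K_def)
  have ball: "\<exists>x M. schreier_le x (real N) \<and> norm (y - lincomb e {..<M} x) < \<epsilon>"
    if y: "norm y < r" and "0 < \<epsilon>" for y \<epsilon>
  proof -
    have "y0 + y \<in> closure (L N)" "y0 - y \<in> closure (L N)"
      using r(2) y by (auto simp: subset_iff dist_norm)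
    then obtain x1 M1 x2 M2 where 1: "schreier_le x1 (real N)" "dist (lincomb e {..<M1} x1) (y0 + y) < \<epsilon>"
      and 2: "schreier_le x2 (real N)" "dist (lincomb e {..<M2} x2) (y0 - y) < \<epsilon>"
      using \<open>0 < \<epsilon>\<close> unfolding closure_approachable L_def by blast
    \<comment> \<open>The ball is centred at \<open>y0\<close>, but \<open>y\<close> is half the
      difference of \<open>y0 + y\<close> and \<open>y0 - y\<close>; half the difference of their
      lifts again has bound \<open>N\<close>.\<close>
    define x where "x n = (1/2) * (restr {..<M1} x1 n - restr {..<M2} x2 n)" for n
    have x: "schreier_le x (\<bar>1/2\<bar> * (real N + real N))"
      unfolding x_def by (intro schreier_le_cmult schreier_le_diff schreier_le_restr 1 2)
    have "lincomb e {..<max M1 M2} x = (1/2) *\<^sub>R (lincomb e {..<M1} x1 - lincomb e {..<M2} x2)"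
      unfolding x_def lincomb_cmult lincomb_diff by (simp add: lincomb_restr_subset)
    then have "y - lincomb e {..<max M1 M2} x
        = (1/2) *\<^sub>R (2 *\<^sub>R y - (lincomb e {..<M1} x1 - lincomb e {..<M2} x2))"
      by (simp add: scaleR_diff_right)
    also have "2 *\<^sub>R y - (lincomb e {..<M1} x1 - lincomb e {..<M2} x2)
        = (y0 + y - lincomb e {..<M1} x1) - (y0 - y - lincomb e {..<M2} x2)"
      by (simp add: scaleR_2)
    finally have "norm (y - lincomb e {..<max M1 M2} x)
        \<le> (1/2) * (norm (y0 + y - lincomb e {..<M1} x1) + norm (y0 - y - lincomb e {..<M2} x2))"
      using norm_triangle_ineq4[of "y0 + y - lincomb e {..<M1} x1" "y0 - y - lincomb e {..<M2} x2"] by simp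
    then have "norm (y - lincomb e {..<max M1 M2} x) < \<epsilon>"
      using 1(2) 2(2) by (simp add: dist_norm norm_minus_commute)
    with x show ?thesis by auto
  qed
  have "schreier_lifting e C K"
  proof
    show "0 < C" "0 < K" using \<open>K > 0\<close> by (simp_all add: C_def)
  next
    fix A :: "nat set" and x s assume "finite A" "schreier_le x s"
    then show "norm (lincomb e A x) \<le> C * s"
      using C[OF fin schreier_le_restr] by (simp add: T_restr)
  next
    fix \<epsilon> :: real and y :: 'a assume "0 < \<epsilon>"
    show "\<exists>x M. schreier_le x (K * norm y) \<and> norm (y - lincomb e {..<M} x) < \<epsilon>"
    proof (cases "y = 0")
      case True
      then show ?thesis using \<open>0 < \<epsilon>\<close> schreier_le_zero[of 0]
        by (intro exI[of _ "\<lambda>_. 0"]) (simp add: lincomb_def)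
    next
      case False
      define a where "a = 2 * norm y / r"
      have "a > 0" using False r by (simp add: a_def)
      have "norm ((1/a) *\<^sub>R y) < r" using False r by (simp add: a_def)
      moreover have "0 < \<epsilon> / a" using \<open>0 < \<epsilon>\<close> \<open>a > 0\<close> by simp
      ultimately obtain x M where x: "schreier_le x (real N)"
        "norm ((1/a) *\<^sub>R y - lincomb e {..<M} x) < \<epsilon> / a"
        using ball by blast
      have "schreier_le (\<lambda>n. a * x n) (K * norm y)"
        by (rule schreier_le_mono[OF schreier_le_cmult[OF x(1)]])
          (use \<open>a > 0\<close> r in \<open>simp add: a_def K_def field_simps\<close>)
      moreover have "y - lincomb e {..<M} (\<lambda>n. a * x n) = a *\<^sub>R ((1/a) *\<^sub>R y - lincomb e {..<M} x)"
        using \<open>a > 0\<close> by (simp add: lincomb_cmult scaleR_diff_right)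
      then have "norm (y - lincomb e {..<M} (\<lambda>n. a * x n)) < \<epsilon>"
        using x(2) \<open>a > 0\<close> by (simp add: pos_less_divide_eq mult.commute)
      ultimately show ?thesis by blast
    qed
  qed
  then show thesis by (rule that)
qed

subsection \<open>Block lifts and Mazur selection\<close>

text \<open>Riesz's lemma with constant 1/2: the span of the vectors chosen so far is closed and
  proper, and \<open>z - v\<close> is normalized for a \<open>v\<close> in it within twice the
  distance of \<open>z\<close>.\<close>

lemma infinite_dimensional_separated_sequence:
  fixes Z :: "'a::real_normed_vector set"
  assumes Z: "subspace Z" "infinite_dimensional Z"
  obtains z :: "nat \<Rightarrow> 'a" where "\<And>n. z n \<in> Z" "\<And>n. norm (z n) = 1"
    "\<And>m n. m \<noteq> n \<Longrightarrow> 1/2 \<le> norm (z m - z n)"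
proof -
  let ?P = "\<lambda>(f :: nat \<Rightarrow> 'a) n r. r \<in> Z \<and> norm r = 1 \<and> (\<forall>m<n. 1/2 \<le> norm (r - f m))"
  have "\<exists>f. \<forall>n. ?P f n (f n)"
  proof (rule dependent_wellorder_choice[where P = ?P])
    fix n :: nat and f :: "nat \<Rightarrow> 'a"
    assume f: "\<And>m. m < n \<Longrightarrow> ?P f m (f m)"
    define V where "V = span (f ` {..<n})"
    have "V \<subseteq> Z" unfolding V_def using f Z(1) by (intro span_minimal) auto
    moreover have "V \<noteq> Z" using Z(2) unfolding V_def infinite_dimensional_def by blast
    ultimately obtain z where z: "z \<in> Z" "z \<notin> V" by blast
    define d where "d = infdist z V"
    have "V \<noteq> {}" unfolding V_def using span_zero by blast
    have "0 < d"
      unfolding d_def using z(2) \<open>V \<noteq> {}\<close>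
      by (intro infdist_pos_not_in_closed) (auto simp: V_def intro: closed_span_finite)
    then obtain v where v: "v \<in> V" "dist z v < 2 * d"
      using cINF_less_iff[of V "dist z" "2 * d"] \<open>V \<noteq> {}\<close>
      by (auto simp: d_def infdist_notempty intro: bdd_belowI2[where m = 0])
    define r where "r = (1 / norm (z - v)) *\<^sub>R (z - v)"
    have pos: "0 < norm (z - v)" using z v by auto
    have "r \<in> Z" unfolding r_def using Z(1) z v \<open>V \<subseteq> Z\<close> by (intro subspace_scale subspace_diff) auto
    moreover have "norm r = 1" unfolding r_def using pos by simp
    moreover have "1/2 \<le> norm (r - f m)" if "m < n" for m
    proof -
      have "v + norm (z - v) *\<^sub>R f m \<in> V"
        using v(1) that unfolding V_def by (intro span_add span_scale[OF span_base]) auto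
      then have "d \<le> dist z (v + norm (z - v) *\<^sub>R f m)" unfolding d_def by (rule infdist_le)
      also have "\<dots> = norm (norm (z - v) *\<^sub>R (r - f m))"
        unfolding r_def using pos by (simp add: dist_norm scaleR_diff_right algebra_simps)
      finally have "d \<le> norm (z - v) * norm (r - f m)" by simp
      also have "\<dots> \<le> 2 * d * norm (r - f m)"
        using v(2) by (intro mult_right_mono) (auto simp: dist_norm)
      finally show ?thesis using \<open>0 < d\<close> by simp
    qed
    ultimately show "\<exists>r. ?P f n r" by blast
  qed auto
  then obtain f where f: "\<And>n. ?P f n (f n)" by blast
  have "1/2 \<le> norm (f m - f n)" if "m \<noteq> n" for m n
    using f[of m] f[of n] that by (cases m n rule: linorder_cases) (auto simp: norm_minus_commute)
  with f show thesis by (intro that[of f]) auto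
qed

context schreier_lifting
begin

text \<open>The heads, up to \<open>N\<close>, of bounded lifts of a separated sequence have images
  in a compact set, so two of these images nearly agree. The difference of the two lifts may then
  lose its head at small cost.\<close>

lemma tail_vector:
  assumes Z: "subspace Z" "infinite_dimensional Z" and "0 < \<epsilon>"
  obtains y u M where "y \<in> Z" "1/2 \<le> norm y" "norm y \<le> 2" "N < M"
    "schreier_le u (2 * K)" "\<And>n. n < N \<or> M \<le> n \<Longrightarrow> u n = 0"
    "norm (y - lincomb e {..<M} u) \<le> \<epsilon>"
proof -
  obtain z :: "nat \<Rightarrow> 'a" where z: "\<And>n. z n \<in> Z" "\<And>n. norm (z n) = 1"
    "\<And>m n. m \<noteq> n \<Longrightarrow> 1/2 \<le> norm (z m - z n)"
    by (rule infinite_dimensional_separated_sequence[OF Z]) (rule that)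
  have "\<forall>n. \<exists>x M. schreier_le x K \<and> norm (z n - lincomb e {..<M} x) < \<epsilon> / 3"
    using lift[of "\<epsilon> / 3"] \<open>0 < \<epsilon>\<close> z(2) by (metis divide_pos_pos mult.right_neutral zero_less_numeral)
  then obtain x M where x: "\<And>n. schreier_le (x n) K"
    and M: "\<And>n. norm (z n - lincomb e {..<M n} (x n)) < \<epsilon> / 3"
    by metis
  define x' where "x' n = restr {..<M n} (x n)" for n
  have x': "schreier_le (x' n) K" for n unfolding x'_def by (intro schreier_le_restr x)
  define a where "a n = lincomb e {..<N} (x' n)" for n
  have "a n \<in> span (e ` {..<N}) \<inter> cball 0 (C * K)" for n
    using lincomb_in_span[of e "{..<N}"] lincomb_bound[OF finite_lessThan x'[of n]] by (simp add: a_def)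
  then obtain l r where "strict_mono r" "(a \<circ> r) \<longlonglongrightarrow> l"
    using compact_span_cball[of "e ` {..<N}" "C * K"] unfolding compact_def by blast
  then have "Cauchy (a \<circ> r)" by (intro LIMSEQ_imp_Cauchy)
  then obtain i where "dist ((a \<circ> r) i) ((a \<circ> r) (Suc i)) < \<epsilon> / 3"
    using \<open>0 < \<epsilon>\<close> unfolding Cauchy_def by (metis divide_pos_pos lessI less_imp_le order_refl zero_less_numeral)
  moreover have "r i \<noteq> r (Suc i)" using \<open>strict_mono r\<close> by (simp add: strict_mono_eq)
  ultimately obtain p q where pq: "p \<noteq> q" "norm (a p - a q) < \<epsilon> / 3"
    by (auto simp: dist_norm)
  define M' where "M' = Suc (max N (max (M p) (M q)))"
  define d where "d n = x' p n - x' q n" for n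
  have d: "schreier_le d (2 * K)"
    using schreier_le_diff[OF x'[of p] x'[of q]] unfolding d_def[abs_def] by simp
  have dM: "lincomb e {..<M'} d = lincomb e {..<M p} (x p) - lincomb e {..<M q} (x q)"
    unfolding d_def lincomb_diff x'_def by (subst (1 2) lincomb_restr_subset) (auto simp: M'_def)
  have dN: "lincomb e {..<N} d = a p - a q"
    unfolding d_def lincomb_diff a_def ..
  define u where "u = restr {N..} d"
  have "lincomb e {..<M'} u = lincomb e ({N..<M'}) d"
    unfolding u_def by (simp add: lincomb_restr) (rule arg_cong[of _ _ "\<lambda>A. lincomb e A d"], auto)
  moreover have "lincomb e {..<M'} d = lincomb e {..<N} d + lincomb e {N..<M'} d"
    by (rule lincomb_split) (simp add: M'_def)
  ultimately have "z p - z q - lincomb e {..<M'} u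
      = (z p - lincomb e {..<M p} (x p)) - (z q - lincomb e {..<M q} (x q)) + (a p - a q)"
    using dM dN by (simp add: algebra_simps)
  also have "norm \<dots> \<le> norm (z p - lincomb e {..<M p} (x p)) + norm (z q - lincomb e {..<M q} (x q))
      + norm (a p - a q)"
    by (intro norm_triangle_le add_right_mono norm_triangle_ineq4)
  also have "\<dots> \<le> \<epsilon>" using M[of p] M[of q] pq(2) by simp
  finally have err: "norm (z p - z q - lincomb e {..<M'} u) \<le> \<epsilon>" .
  show thesis
  proof (rule that[OF _ _ _ _ _ _ err])
    show "z p - z q \<in> Z" using Z(1) z(1) by (intro subspace_diff)
    show "1/2 \<le> norm (z p - z q)" using z(3) pq(1) by blast
    show "norm (z p - z q) \<le> 2" using norm_triangle_ineq4[of "z p" "z q"] z(2) by simp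
    show "N < M'" by (simp add: M'_def)
    show "schreier_le u (2 * K)" unfolding u_def by (intro schreier_le_restr d)
    show "u n = 0" if "n < N \<or> M' \<le> n" for n
      using that by (auto simp: u_def d_def x'_def restr_def M'_def)
  qed
qed

text \<open>The gauge of \<open>T (ball of the vectors supported in [m, \<infinity>)) + ball / (m + 1)\<close>, up to a
  factor \<open>2\<close>. Each \<open>tail_gauge m\<close> is an equivalent norm, but on a fixed nonzero vector they tend to
  infinity because bounded block sequences have convex combinations tending to \<open>0\<close>.\<close>

definition tail_gauge :: "nat \<Rightarrow> 'a \<Rightarrow> real" where
  "tail_gauge m y = Inf {s + (real m + 1) * norm (y - lincomb e {m..<M} x) | s x M. schreier_le x s}"

lemma tail_gauge_aux:
  "bdd_below {s + (real m + 1) * norm (y - lincomb e {m..<M} x) | s x M. schreier_le x s}"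
  "{s + (real m + 1) * norm (y - lincomb e {m..<M} x) | s x M. schreier_le x s} \<noteq> {}"
proof -
  show "bdd_below {s + (real m + 1) * norm (y - lincomb e {m..<M} x) | s x M. schreier_le x s}"
    by (rule bdd_belowI[of _ 0]) (auto dest!: schreier_le_nonneg)
  show "{s + (real m + 1) * norm (y - lincomb e {m..<M} x) | s x M. schreier_le x s} \<noteq> {}"
    using schreier_le_zero[of 0] by blast
qed

lemma tail_gauge_le: "schreier_le x s \<Longrightarrow> tail_gauge m y \<le> s + (real m + 1) * norm (y - lincomb e {m..<M} x)"
  unfolding tail_gauge_def by (rule cInf_lower[OF _ tail_gauge_aux(1)]) blast

lemma tail_gauge_less:
  assumes "tail_gauge m y < t"
  obtains s x M where "schreier_le x s" "s + (real m + 1) * norm (y - lincomb e {m..<M} x) < t"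
  using assms unfolding tail_gauge_def cInf_less_iff[OF tail_gauge_aux(2,1)] by blast

lemma tail_gauge_lower: "norm y \<le> (C + 1) * tail_gauge m y"
proof (rule field_le_epsilon)
  fix \<epsilon> :: real assume "0 < \<epsilon>"
  then have "tail_gauge m y < tail_gauge m y + \<epsilon> / (C + 1)" using C_pos by simp
  then obtain s x M where x: "schreier_le x s"
    "s + (real m + 1) * norm (y - lincomb e {m..<M} x) < tail_gauge m y + \<epsilon> / (C + 1)" (is "s + _ * ?d < _")
    by (rule tail_gauge_less)
  have "norm y \<le> norm (lincomb e {m..<M} x) + ?d"
    using norm_triangle_ineq[of "lincomb e {m..<M} x" "y - lincomb e {m..<M} x"] by simp
  also have "\<dots> \<le> C * s + ?d" using lincomb_bound[OF _ x(1)] by simp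
  also have "\<dots> \<le> (C + 1) * (s + (real m + 1) * ?d)"
  proof -
    have "1 * ?d \<le> ((C + 1) * (real m + 1)) * ?d"
      using C_pos by (intro mult_right_mono) (auto simp: algebra_simps)
    then show ?thesis using schreier_le_nonneg[OF x(1)] by (simp add: algebra_simps)
  qed
  also have "\<dots> \<le> (C + 1) * (tail_gauge m y + \<epsilon> / (C + 1))" using x(2) C_pos by (intro mult_left_mono) auto
  finally show "norm y \<le> (C + 1) * tail_gauge m y + \<epsilon>" using C_pos by (simp add: distrib_left)
qed

lemma tail_gauge_upper: "tail_gauge m y \<le> (real m + 1) * norm y"
  using tail_gauge_le[OF schreier_le_zero[of 0], of m y 0] by (simp add: lincomb_def)

lemma tail_gauge_add: "tail_gauge m (y + z) \<le> tail_gauge m y + tail_gauge m z"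
proof (rule field_le_epsilon)
  fix \<epsilon> :: real assume "0 < \<epsilon>"
  obtain s x M where x: "schreier_le x s"
    "s + (real m + 1) * norm (y - lincomb e {m..<M} x) < tail_gauge m y + \<epsilon> / 2"
    by (rule tail_gauge_less[of m y "tail_gauge m y + \<epsilon> / 2"]) (use \<open>0 < \<epsilon>\<close> in auto)
  obtain s' x' M' where x': "schreier_le x' s'"
    "s' + (real m + 1) * norm (z - lincomb e {m..<M'} x') < tail_gauge m z + \<epsilon> / 2"
    by (rule tail_gauge_less[of m z "tail_gauge m z + \<epsilon> / 2"]) (use \<open>0 < \<epsilon>\<close> in auto)
  define v where "v n = restr {m..<M} x n + restr {m..<M'} x' n" for n
  have v: "schreier_le v (s + s')"
    unfolding v_def by (intro schreier_le_add schreier_le_restr x x')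
  have "lincomb e {m..<max M M'} v = lincomb e {m..<M} x + lincomb e {m..<M'} x'"
    unfolding v_def lincomb_add by (subst (1 2) lincomb_restr_subset) auto
  then have "norm (y + z - lincomb e {m..<max M M'} v)
      \<le> norm (y - lincomb e {m..<M} x) + norm (z - lincomb e {m..<M'} x')"
    using norm_triangle_ineq[of "y - lincomb e {m..<M} x" "z - lincomb e {m..<M'} x'"]
    by (simp add: algebra_simps)
  then have "(real m + 1) * norm (y + z - lincomb e {m..<max M M'} v)
      \<le> (real m + 1) * (norm (y - lincomb e {m..<M} x) + norm (z - lincomb e {m..<M'} x'))"
    by (rule mult_left_mono) simp
  then show "tail_gauge m (y + z) \<le> tail_gauge m y + tail_gauge m z + \<epsilon>"
    using tail_gauge_le[OF v, of m "y + z" "max M M'"] x(2) x'(2) by (simp add: distrib_left)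
qed

lemma tail_gauge_scale: "tail_gauge m (a *\<^sub>R y) = \<bar>a\<bar> * tail_gauge m y"
proof -
  \<comment> \<open>The reverse inequality is the instance for \<open>1 / a\<close> and
    \<open>a *\<^sub>R y\<close>.\<close>
  have le: "tail_gauge m (a *\<^sub>R y) \<le> \<bar>a\<bar> * tail_gauge m y" if a: "a \<noteq> 0" for a y
  proof (rule field_le_epsilon)
    fix \<epsilon> :: real assume "0 < \<epsilon>"
    obtain s x M where x: "schreier_le x s"
      "s + (real m + 1) * norm (y - lincomb e {m..<M} x) < tail_gauge m y + \<epsilon> / \<bar>a\<bar>"
      by (rule tail_gauge_less[of m y "tail_gauge m y + \<epsilon> / \<bar>a\<bar>"]) (use \<open>0 < \<epsilon>\<close> a in auto)
    have "tail_gauge m (a *\<^sub>R y) \<le> \<bar>a\<bar> * s + (real m + 1) * norm (a *\<^sub>R y - lincomb e {m..<M} (\<lambda>n. a * x n))"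
      by (rule tail_gauge_le[OF schreier_le_cmult[OF x(1)]])
    also have "\<dots> = \<bar>a\<bar> * (s + (real m + 1) * norm (y - lincomb e {m..<M} x))"
      unfolding lincomb_cmult scaleR_diff_right[symmetric] norm_scaleR by (simp add: algebra_simps)
    also have "\<dots> \<le> \<bar>a\<bar> * (tail_gauge m y + \<epsilon> / \<bar>a\<bar>)" using x(2) by (intro mult_left_mono) auto
    finally show "tail_gauge m (a *\<^sub>R y) \<le> \<bar>a\<bar> * tail_gauge m y + \<epsilon>" using a by (simp add: distrib_left)
  qed
  show ?thesis
  proof (cases "a = 0")
    case True
    then show ?thesis using tail_gauge_upper[of m 0] tail_gauge_lower[of 0 m] C_pos by (simp add: zero_le_mult_iff)
  next
    case False
    then have "tail_gauge m ((1/a) *\<^sub>R (a *\<^sub>R y)) \<le> \<bar>1/a\<bar> * tail_gauge m (a *\<^sub>R y)" by (intro le) simp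
    then have "\<bar>a\<bar> * tail_gauge m y \<le> tail_gauge m (a *\<^sub>R y)" using False by (simp add: field_simps)
    with le[OF False] show ?thesis by (simp add: antisym)
  qed
qed

end

section \<open>Equivalent norms and block sequences with bounded lifts\<close>

definition equivalent_norm :: "('a::real_normed_vector \<Rightarrow> real) \<Rightarrow> bool" where
  "equivalent_norm p \<longleftrightarrow> (\<forall>x y. p (x + y) \<le> p x + p y) \<and> (\<forall>a x. p (a *\<^sub>R x) = \<bar>a\<bar> * p x) \<and>
     (\<exists>A>0. \<forall>x. A * norm x \<le> p x) \<and> (\<exists>B>0. \<forall>x. p x \<le> B * norm x)"

lemma equivalent_norm_norm: "equivalent_norm norm"
  unfolding equivalent_norm_def using norm_triangle_ineq by (auto intro!: exI[of _ 1])

lemma (in schreier_lifting) equivalent_norm_tail_gauge: "equivalent_norm (tail_gauge m)"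
  unfolding equivalent_norm_def
proof (intro conjI allI)
  show "\<exists>A>0. \<forall>x. A * norm x \<le> tail_gauge m x"
    using tail_gauge_lower C_pos by (intro exI[of _ "1 / (C + 1)"]) (auto simp: field_simps)
  show "\<exists>B>0. \<forall>x. tail_gauge m x \<le> B * norm x"
    using tail_gauge_upper by (intro exI[of _ "real m + 1"]) auto
qed (auto simp: tail_gauge_add tail_gauge_scale)

lemma equivalent_norm_sum:
  assumes "equivalent_norm p"
  shows "p (\<Sum>i\<in>I. f i) \<le> (\<Sum>i\<in>I. p (f i))"
proof -
  have "p 0 = \<bar>0\<bar> * p 0" using assms unfolding equivalent_norm_def by (metis scale_zero_left)
  then have "p 0 = 0" by simp
  moreover have "p (x + y) \<le> p x + p y" for x y using assms by (simp add: equivalent_norm_def)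
  ultimately show ?thesis
    by (induction I rule: infinite_finite_induct) (auto intro: order_trans[OF _ add_left_mono])
qed

text \<open>The constants 1/2, 2 and \<open>2 * K\<close> are those of differences of normalized,
  1/2-separated vectors. The lifts are only approximate, with summable errors.\<close>

locale schreier_blocks = schreier_lifting e C K
  for e :: "nat \<Rightarrow> 'a::banach" and C K +
  fixes y :: "nat \<Rightarrow> 'a" and u :: "nat \<Rightarrow> nat \<Rightarrow> real" and pos :: "nat \<Rightarrow> nat"
  assumes pos: "strict_mono pos"
    and y_ge: "1/2 \<le> norm (y j)" and y_le: "norm (y j) \<le> 2"
    and u_le: "schreier_le (u j) (2 * K)"
    and u_supp: "n < pos j \<or> pos (Suc j) \<le> n \<Longrightarrow> u j n = 0"
    and u_err: "norm (y j - lincomb e {..<pos (Suc j)} (u j)) \<le> (1/2)^j"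

lemma (in schreier_lifting) schreier_blocks_exist:
  assumes Z: "subspace Z" "infinite_dimensional Z"
  obtains y u pos where "schreier_blocks e C K y u pos" "range y \<subseteq> Z"
proof -
  have "\<exists>y u M. y \<in> Z \<and> 1/2 \<le> norm y \<and> norm y \<le> 2 \<and> N < M \<and>
    schreier_le u (2 * K) \<and> (\<forall>n. n < N \<or> M \<le> n \<longrightarrow> u n = 0) \<and>
    norm (y - lincomb e {..<M} u) \<le> (1/2)^j" for N j :: nat
    by (rule tail_vector[OF Z, of "(1/2)^j" N]) (simp, blast)
  then obtain Y U M where *: "\<And>N j. Y N j \<in> Z \<and> 1/2 \<le> norm (Y N j) \<and> norm (Y N j) \<le> 2 \<and> N < M N j \<and>
    schreier_le (U N j) (2 * K) \<and> (\<forall>n. n < N \<or> M N j \<le> n \<longrightarrow> U N j n = 0) \<and>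
    norm (Y N j - lincomb e {..<M N j} (U N j)) \<le> (1/2)^j"
    by metis
  define pos where "pos = rec_nat 0 (\<lambda>j N. M N j)"
  have posS: "pos (Suc j) = M (pos j) j" for j by (simp add: pos_def)
  have "schreier_blocks e C K (\<lambda>j. Y (pos j) j) (\<lambda>j. U (pos j) j) pos"
  proof
    show "strict_mono pos" unfolding strict_mono_Suc_iff using * posS by simp
  qed (use * in \<open>auto simp: posS\<close>)
  moreover have "range (\<lambda>j. Y (pos j) j) \<subseteq> Z" using * by auto
  ultimately show thesis by (rule that)
qed

context schreier_blocks
begin

lemma pos_mono: "i \<le> j \<Longrightarrow> pos i \<le> pos j"
  using pos by (simp add: strict_mono_less_eq)

lemma subsequence:
  assumes s: "strict_mono s"
  shows "schreier_blocks e C K (y \<circ> s) (u \<circ> s) (pos \<circ> s)"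
proof
  show "strict_mono (pos \<circ> s)" using pos s by (simp add: strict_mono_o)
next
  fix j
  have le: "Suc (s j) \<le> s (Suc j)" using s by (simp add: strict_mono_Suc_iff Suc_leI)
  fix n assume "n < (pos \<circ> s) j \<or> (pos \<circ> s) (Suc j) \<le> n"
  then show "(u \<circ> s) j n = 0" using u_supp[of n "s j"] pos_mono[OF le] by auto
next
  fix j
  have le: "Suc (s j) \<le> s (Suc j)" using s by (simp add: strict_mono_Suc_iff Suc_leI)
  have "lincomb e {..<pos (s (Suc j))} (u (s j)) = lincomb e {..<pos (Suc (s j))} (u (s j))"
    by (rule lincomb_mono_neutral) (use pos_mono[OF le] u_supp[of _ "s j"] in auto)
  moreover have "(1/2::real)^(s j) \<le> (1/2)^j"
    using s by (intro power_decreasing) (auto intro: strict_mono_imp_increasing)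
  ultimately show "norm ((y \<circ> s) j - lincomb e {..<(pos \<circ> s) (Suc j)} ((u \<circ> s) j)) \<le> (1/2)^j"
    using order_trans[OF u_err[of "s j"]] by simp
qed (use y_ge y_le u_le in auto)

text \<open>This takes the place of weak convergence to 0 in the classical Mazur construction. The
  combined lifts are small by \<open>schreier_convex_weights\<close>, and each lifting error is at
  most \<open>(1/2)^(s 0)\<close>.\<close>

lemma convex_combination_small:
  fixes s :: "nat \<Rightarrow> nat"
  assumes "strict_mono s" "0 < \<epsilon>"
  obtains m :: nat and c :: "nat \<Rightarrow> real" where "\<And>j. 0 \<le> c j" "(\<Sum>j<m. c j) = 1"
    "norm (\<Sum>j<m. c j *\<^sub>R y (s j)) \<le> \<epsilon> + (1/2)^(s 0)"
proof -
  interpret s: schreier_blocks e C K "y \<circ> s" "u \<circ> s" "pos \<circ> s" by (rule subsequence[OF assms(1)])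
  obtain m :: nat and c :: "nat \<Rightarrow> real" where c: "\<And>j. 0 \<le> c j" "(\<Sum>j<m. c j) = 1"
    and small: "\<And>t. (\<And>j n. n < (pos \<circ> s) j \<or> (pos \<circ> s) (Suc j) \<le> n \<Longrightarrow> t j n = 0)
      \<Longrightarrow> (\<And>j. schreier_le (t j) (2 * K)) \<Longrightarrow> schreier_le (\<lambda>n. \<Sum>j<m. c j * t j n) (\<epsilon> / C)"
    by (rule schreier_convex_weights[OF s.pos, of "2 * K" "\<epsilon> / C"])
      (use K_pos C_pos \<open>0 < \<epsilon>\<close> in auto)
  have le: "schreier_le (\<lambda>n. \<Sum>j<m. c j * (u \<circ> s) j n) (\<epsilon> / C)"
    by (rule small) (use s.u_supp s.u_le in auto)
  let ?L = "lincomb e {..<pos (s m)}"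
  have err: "norm (y (s j) - ?L (u (s j))) \<le> (1/2)^(s 0)" if "j < m" for j
  proof -
    have "Suc (s j) \<le> s m" using assms(1) that by (simp add: Suc_leI strict_mono_less)
    then have "?L (u (s j)) = lincomb e {..<pos (Suc (s j))} (u (s j))"
      by (intro lincomb_mono_neutral) (use pos_mono u_supp[of _ "s j"] in auto)
    moreover have "(1/2::real)^(s j) \<le> (1/2)^(s 0)"
      using assms(1) by (intro power_decreasing) (auto simp: strict_mono_less_eq)
    ultimately show ?thesis using order_trans[OF u_err[of "s j"]] by simp
  qed
  have eq: "(\<Sum>j<m. c j *\<^sub>R y (s j)) = ?L (\<lambda>n. \<Sum>j<m. c j * (u \<circ> s) j n) + (\<Sum>j<m. c j *\<^sub>R (y (s j) - ?L (u (s j))))"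
    by (simp add: lincomb_sum lincomb_cmult scaleR_diff_right sum_subtractf)
  have 1: "norm (?L (\<lambda>n. \<Sum>j<m. c j * (u \<circ> s) j n)) \<le> \<epsilon>"
    using lincomb_bound[OF finite_lessThan le, of "pos (s m)"] C_pos by simp
  have "norm (\<Sum>j<m. c j *\<^sub>R (y (s j) - ?L (u (s j)))) \<le> (\<Sum>j<m. c j * (1/2)^(s 0))"
    by (rule sum_norm_le) (use c(1) err in \<open>auto intro!: mult_left_mono\<close>)
  also have "\<dots> = (1/2)^(s 0)" by (simp add: sum_distrib_right[symmetric] c(2))
  finally have 2: "norm (\<Sum>j<m. c j *\<^sub>R (y (s j) - ?L (u (s j)))) \<le> (1/2)^(s 0)" .
  show thesis
  proof (rule that[OF c])
    show "norm (\<Sum>j<m. c j *\<^sub>R y (s j)) \<le> \<epsilon> + (1/2)^(s 0)"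
      unfolding eq by (rule norm_triangle_le[OF add_mono[OF 1 2]])
  qed
qed

text \<open>If the inequality failed for infinitely many \<open>k\<close>, compactness would make it fail with the
  same \<open>v\<close> and \<open>t\<close> up to a small error; a small convex combination of these \<open>y k\<close> would then
  give \<open>p v < p v\<close>.\<close>

lemma mazur_selection:
  assumes p: "equivalent_norm p" and G: "finite G" and \<theta>: "\<theta> < 1"
  shows "\<exists>J. \<forall>k\<ge>J. \<forall>v\<in>span G. \<forall>t. \<theta> * p v \<le> p (v + t *\<^sub>R y k)"
proof (rule ccontr)
  assume contr: "\<not> ?thesis"
  have p_add: "p (v + w) \<le> p v + p w" and p_scale: "p (a *\<^sub>R v) = \<bar>a\<bar> * p v" for v w a
    using p by (auto simp: equivalent_norm_def)
  obtain A B where AB: "0 < A" "\<And>v. A * norm v \<le> p v" "0 < B" "\<And>v. p v \<le> B * norm v"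
    using p unfolding equivalent_norm_def by blast
  have p_nonneg: "0 \<le> p v" for v using AB(1) order_trans[OF _ AB(2)[of v]] by simp
  have p_minus: "p (- v) = p v" for v using p_scale[of "-1" v] by simp
  define S where "S = {k. \<exists>v t. v \<in> span G \<and> p v = 1 \<and> p (v + t *\<^sub>R y k) < \<theta>}"
  have "\<exists>k\<ge>J. k \<in> S" for J
  proof -
    obtain k v t where k: "J \<le> k" "v \<in> span G" "p (v + t *\<^sub>R y k) < \<theta> * p v"
      using contr by (meson not_le)
    then have "p v \<noteq> 0" using p_nonneg[of "v + t *\<^sub>R y k"] by auto
    then have pv: "p v > 0" using p_nonneg[of v] by simp
    have "p ((1 / p v) *\<^sub>R v + (t / p v) *\<^sub>R y k) = p (v + t *\<^sub>R y k) / p v"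
      using p_scale[of "1 / p v" "v + t *\<^sub>R y k"] pv by (simp add: scaleR_add_right)
    also have "\<dots> < \<theta>" using k(3) pv by (simp add: pos_divide_less_eq)
    finally have "p ((1 / p v) *\<^sub>R v + (t / p v) *\<^sub>R y k) < \<theta>" .
    moreover have "(1 / p v) *\<^sub>R v \<in> span G" using k(2) by (rule span_scale)
    moreover have "p ((1 / p v) *\<^sub>R v) = 1" using pv by (simp add: p_scale)
    ultimately show ?thesis using k(1) unfolding S_def by blast
  qed
  then have "infinite S" by (simp add: infinite_nat_iff_unbounded_le)
  then obtain k :: "nat \<Rightarrow> nat" where k: "strict_mono k" "\<And>n. k n \<in> S" using infinite_enumerate[of S] by auto
  then have "\<forall>n. \<exists>v t. v \<in> span G \<and> p v = 1 \<and> p (v + t *\<^sub>R y (k n)) < \<theta>" by (simp add: S_def)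
  then obtain v t where vt: "\<And>n. v n \<in> span G" "\<And>n. p (v n) = 1"
    "\<And>n. p (v n + t n *\<^sub>R y (k n)) < \<theta>" by metis
  have "norm (v n) \<le> 1 / A" for n using AB(2)[of "v n"] AB(1) vt(2) by (simp add: field_simps)
  \<comment> \<open>\<open>t n\<close> times \<open>y (k n)\<close> is a difference of two vectors
    with \<open>p\<close> at most 1, while \<open>y (k n)\<close> has norm at least 1/2.\<close>
  moreover have "\<bar>t n\<bar> \<le> 4 / A" for n
  proof -
    have "\<bar>t n\<bar> * (A * (1/2)) \<le> \<bar>t n\<bar> * (A * norm (y (k n)))"
      using y_ge AB(1) by (intro mult_left_mono) auto
    also have "\<dots> \<le> \<bar>t n\<bar> * p (y (k n))" using AB(2) by (intro mult_left_mono) auto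
    also have "\<dots> = p ((v n + t n *\<^sub>R y (k n)) + - v n)" by (simp add: p_scale)
    also have "\<dots> \<le> p (v n + t n *\<^sub>R y (k n)) + p (- v n)" by (rule p_add)
    also have "\<dots> \<le> 2" using vt \<theta> less_imp_le[OF vt(3)[of n]] by (simp add: p_minus)
    finally show ?thesis using AB(1) by (simp add: field_simps)
  qed
  ultimately have "(v n, t n) \<in> (span G \<inter> cball 0 (1/A)) \<times> {-4/A..4/A}" for n
    using vt(1) by (auto simp: abs_le_iff) (metis minus_le_iff)
  moreover have "compact ((span G \<inter> cball 0 (1/A)) \<times> {-4/A..4/A})"
    by (intro compact_Times compact_span_cball G compact_Icc)
  ultimately obtain l r where r: "strict_mono r" "((\<lambda>n. (v n, t n)) \<circ> r) \<longlonglongrightarrow> l"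
    unfolding compact_def by (metis (no_types, lifting))
  define v' t' where "v' = fst l" and "t' = snd l"
  have lim: "(\<lambda>n. v (r n)) \<longlonglongrightarrow> v'" "(\<lambda>n. t (r n)) \<longlonglongrightarrow> t'"
    using tendsto_fst[OF r(2)] tendsto_snd[OF r(2)] by (simp_all add: v'_def t'_def o_def)
  \<comment> \<open>The final estimate reads \<open>1 < \<theta> + 4 * \<delta>\<close>, which is
    false for a fifth of the gap.\<close>
  define \<delta> where "\<delta> = (1 - \<theta>) / 5"
  have "\<delta> > 0" using \<theta> by (simp add: \<delta>_def)
  have "(\<lambda>n. B * norm (v' - v (r n)) + B * (\<bar>t' - t (r n)\<bar> * 2))
      \<longlonglongrightarrow> B * norm (v' - v') + B * (\<bar>t' - t'\<bar> * 2)"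
    by (intro tendsto_intros lim)
  then have "(\<lambda>n. B * norm (v' - v (r n)) + B * (\<bar>t' - t (r n)\<bar> * 2)) \<longlonglongrightarrow> 0" by simp
  then have "\<forall>\<^sub>F n in sequentially. B * norm (v' - v (r n)) + B * (\<bar>t' - t (r n)\<bar> * 2) < \<delta>"
    using \<open>\<delta> > 0\<close> by (rule order_tendstoD(2))
  then obtain I1 where I1: "\<And>n. I1 \<le> n \<Longrightarrow> B * norm (v' - v (r n)) + B * (\<bar>t' - t (r n)\<bar> * 2) < \<delta>"
    unfolding eventually_sequentially by blast
  define \<delta>' where "\<delta>' = \<delta> / (B * \<bar>t'\<bar> + 1)"
  have "0 < \<delta>'" using \<open>\<delta> > 0\<close> AB(3) by (simp add: \<delta>'_def add_nonneg_pos)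
  obtain I2 where I2: "(1/2)^I2 < \<delta>'" using real_arch_pow_inv[OF \<open>0 < \<delta>'\<close>, of "1/2"] by auto
  \<comment> \<open>The shift by \<open>I1\<close> makes \<open>v\<close> and \<open>t\<close> close
    to their limits, the shift by \<open>I2\<close> makes the lifting error
    \<open>(1/2)^(s 0)\<close> smaller than \<open>\<delta>'\<close>.\<close>
  define s where "s i = k (r (i + (I1 + I2)))" for i
  have "strict_mono s" using k(1) r(1) by (auto simp: s_def strict_mono_def)
  obtain m :: nat and c :: "nat \<Rightarrow> real" where c: "\<And>j. 0 \<le> c j" "(\<Sum>j<m. c j) = 1"
    "norm (\<Sum>j<m. c j *\<^sub>R y (s j)) \<le> \<delta>' + (1/2)^(s 0)"
    by (rule convex_combination_small[OF \<open>strict_mono s\<close> \<open>0 < \<delta>'\<close>]) (rule that)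
  have "I2 \<le> s 0"
    using strict_mono_imp_increasing[OF k(1), of "r (I1 + I2)"] strict_mono_imp_increasing[OF r(1), of "I1 + I2"]
    by (simp add: s_def)
  then have "(1/2::real)^(s 0) \<le> (1/2)^I2" by (intro power_decreasing) auto
  with c(3) I2 have small: "norm (\<Sum>j<m. c j *\<^sub>R y (s j)) \<le> 2 * \<delta>'" by linarith
  have each: "p (v' + t' *\<^sub>R y (s j)) \<le> \<theta> + \<delta>" for j
  proof -
    define i where "i = j + (I1 + I2)"
    have "v' + t' *\<^sub>R y (s j) = (v (r i) + t (r i) *\<^sub>R y (s j)) + ((v' - v (r i)) + (t' - t (r i)) *\<^sub>R y (s j))"
      by (simp add: algebra_simps)
    then have "p (v' + t' *\<^sub>R y (s j)) \<le> p (v (r i) + t (r i) *\<^sub>R y (s j)) + (p (v' - v (r i)) + p ((t' - t (r i)) *\<^sub>R y (s j)))"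
      by (metis (no_types, lifting) add_left_mono order_trans p_add)
    also have "p (v (r i) + t (r i) *\<^sub>R y (s j)) \<le> \<theta>" using vt(3)[of "r i"] by (simp add: s_def i_def)
    also have "p (v' - v (r i)) \<le> B * norm (v' - v (r i))" by (rule AB(4))
    also have "p ((t' - t (r i)) *\<^sub>R y (s j)) \<le> B * (\<bar>t' - t (r i)\<bar> * 2)"
      using AB(4)[of "(t' - t (r i)) *\<^sub>R y (s j)"] AB(3) y_le
      by (auto intro!: mult_left_mono elim!: order_trans)
    also have "B * norm (v' - v (r i)) + B * (\<bar>t' - t (r i)\<bar> * 2) \<le> \<delta>"
      using I1[of i] by (simp add: i_def)
    finally show ?thesis by simp
  qed
  \<comment> \<open>The weights sum to 1, so averaging reproduces \<open>v'\<close> while the part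
    along the \<open>y (s j)\<close> becomes small.\<close>
  have "v' + t' *\<^sub>R (\<Sum>j<m. c j *\<^sub>R y (s j)) = (\<Sum>j<m. c j *\<^sub>R (v' + t' *\<^sub>R y (s j)))"
    using c(2) by (simp add: scaleR_add_right sum.distrib scaleR_sum_left[symmetric] scaleR_sum_right mult.commute)
  then have "p (v' + t' *\<^sub>R (\<Sum>j<m. c j *\<^sub>R y (s j))) \<le> (\<Sum>j<m. p (c j *\<^sub>R (v' + t' *\<^sub>R y (s j))))"
    using equivalent_norm_sum[OF p] by simp
  also have "\<dots> \<le> (\<Sum>j<m. c j * (\<theta> + \<delta>))"
    using c(1) each by (intro sum_mono) (simp add: p_scale mult_left_mono)
  also have "\<dots> = \<theta> + \<delta>" using c(2) by (simp add: sum_distrib_right[symmetric])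
  finally have 1: "p (v' + t' *\<^sub>R (\<Sum>j<m. c j *\<^sub>R y (s j))) \<le> \<theta> + \<delta>" .
  let ?w = "t' *\<^sub>R (\<Sum>j<m. c j *\<^sub>R y (s j))"
  have "p ?w \<le> B * (\<bar>t'\<bar> * (2 * \<delta>'))"
    using AB(4)[of ?w] AB(3) small by (auto intro!: mult_left_mono elim!: order_trans)
  also have "\<dots> = 2 * ((B * \<bar>t'\<bar>) * \<delta>')" by simp
  also have "\<dots> \<le> 2 * ((B * \<bar>t'\<bar> + 1) * \<delta>')" using \<open>0 < \<delta>'\<close> by (intro mult_left_mono mult_right_mono) auto
  also have "\<dots> = 2 * \<delta>" using AB(3) by (simp add: \<delta>'_def add_nonneg_eq_0_iff)
  finally have 2: "p ?w \<le> 2 * \<delta>" .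
  have 3: "p v' \<le> p (v' + ?w) + p ?w" using p_add[of "v' + ?w" "- ?w"] by (simp add: p_minus)
  have "1 \<le> p v' + p (v (r I1) - v')" using p_add[of v' "v (r I1) - v'"] vt(2) by simp
  also have "p (v (r I1) - v') \<le> B * norm (v' - v (r I1))" using AB(4) by (metis norm_minus_commute)
  also have "\<dots> < \<delta>" using I1[of I1] AB(3) by (auto elim: le_less_trans[rotated])
  finally have "1 < p v' + \<delta>" by simp
  then have "1 < \<theta> + \<delta> + 2 * \<delta> + \<delta>" using 1 2 3 by linarith
  then show False using \<theta> by (simp add: \<delta>_def field_simps)
qed

end

subsection \<open>Gradual cuts\<close>

lemma span_range_eq_sum:
  fixes f :: "nat \<Rightarrow> 'a::real_vector"
  assumes "r \<in> span (range f)"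
  obtains q :: nat and a :: "nat \<Rightarrow> real" where "r = (\<Sum>i<q. a i *\<^sub>R f i)"
proof -
  have "\<exists>(q::nat) a. r = (\<Sum>i<q. a i *\<^sub>R f i)"
    using assms
  proof (induction rule: span_induct_alt)
    case base
    show ?case by (rule exI[of _ 0]) simp
  next
    case (step c x z)
    then obtain k q a where k: "x = f k" and z: "z = (\<Sum>i<q. a i *\<^sub>R f i)" by auto
    define Q where "Q = max q (Suc k)"
    have "(\<Sum>i<Q. ((if i < q then a i else 0) + (if i = k then c else 0)) *\<^sub>R f i)
        = (\<Sum>i<Q. (if i < q then a i else 0) *\<^sub>R f i) + (\<Sum>i<Q. (if i = k then c else 0) *\<^sub>R f i)"
      by (simp add: scaleR_add_left sum.distrib)
    also have "(\<Sum>i<Q. (if i < q then a i else 0) *\<^sub>R f i) = z"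
      unfolding z by (rule sum.mono_neutral_cong_right) (auto simp: Q_def)
    also have "(\<Sum>i<Q. (if i = k then c else 0) *\<^sub>R f i) = (\<Sum>i\<in>{k}. c *\<^sub>R f i)"
      by (rule sum.mono_neutral_cong_right) (auto simp: Q_def)
    finally have "c *\<^sub>R x + z = (\<Sum>i<Q. ((if i < q then a i else 0) + (if i = k then c else 0)) *\<^sub>R f i)"
      using k by simp
    then show ?case by (intro exI)
  qed
  then show thesis using that by blast
qed

text \<open>The vectors \<open>e n\<close> enter the span because the inequality is applied to
  errors \<open>lincomb e {..<k} x - l\<close> of sharp cuts. The gauges of index at most
  \<open>j\<close> suffice, since a cut at \<open>k\<close> is measured in
  \<open>tail_gauge k\<close>.\<close>

locale schreier_mazur = schreier_blocks e C K y u pos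
  for e :: "nat \<Rightarrow> 'a::banach" and C K y u pos +
  assumes mazur: "p = norm \<or> (\<exists>m\<le>j. p = tail_gauge m) \<Longrightarrow> v \<in> span (e ` {..j} \<union> y ` {..j}) \<Longrightarrow>
    r \<in> span (y ` {j<..}) \<Longrightarrow> p v \<le> 2 * p (v + r)"

text \<open>A diagonal choice: step \<open>j\<close> treats only finitely many norms, and once a
  norm is included it is respected by all later steps.\<close>

lemma (in schreier_blocks) mazur_subsequence:
  obtains s where "strict_mono s" "schreier_mazur e C K (y \<circ> s) (u \<circ> s) (pos \<circ> s)"
proof -
  define P where "P j = insert norm (tail_gauge ` {..j})" for j :: nat
  have P: "equivalent_norm p" if "p \<in> P j" for p j
    using that by (auto simp: P_def equivalent_norm_norm equivalent_norm_tail_gauge)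
  have P_nonneg: "0 \<le> p v" if p: "p \<in> P j" for p j v
  proof -
    obtain A where "0 < A" "A * norm v \<le> p v" using P[OF p] unfolding equivalent_norm_def by blast
    then show ?thesis by (meson less_imp_le mult_nonneg_nonneg norm_ge_zero order_trans)
  qed
  \<comment> \<open>The loss allowed at step \<open>j\<close> is the ratio
    \<open>g j / g (Suc j) < 1\<close>. These ratios telescope, and \<open>g\<close> stays between 1
    and 2, which yields the constant 2.\<close>
  define g where "g j = 2 - 1 / (real j + 1)" for j :: nat
  have g: "1 \<le> g j" "g j \<le> 2" "g j < g (Suc j)" for j by (simp_all add: g_def field_simps)
  define V where "V j n = span (e ` {..j} \<union> y ` {..n})" for j n :: nat
  define good where "good j n k \<longleftrightarrow> (\<forall>p\<in>P j. \<forall>v\<in>V j n. \<forall>t. g j / g (Suc j) * p v \<le> p (v + t *\<^sub>R y k))"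
    for j n k
  have "\<exists>k>n. good j n k" for j n
  proof -
    have "\<exists>J. \<forall>k\<ge>J. \<forall>v\<in>V j n. \<forall>t. g j / g (Suc j) * p v \<le> p (v + t *\<^sub>R y k)" if "p \<in> P j" for p
      unfolding V_def using g[of j] g[of "Suc j"] by (intro mazur_selection P[OF that]) auto
    then have "\<forall>p\<in>P j. \<forall>\<^sub>F k in sequentially. \<forall>v\<in>V j n. \<forall>t. g j / g (Suc j) * p v \<le> p (v + t *\<^sub>R y k)"
      by (simp add: eventually_sequentially)
    then have "\<forall>\<^sub>F k in sequentially. good j n k"
      unfolding good_def by (intro eventually_ball_finite) (auto simp: P_def)
    from eventually_happens'[OF _ eventually_conj[OF this eventually_gt_at_top[of n]]]
    show ?thesis by auto
  qed
  then have ex: "\<exists>k. n < k \<and> good j n k" for j n by blast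
  define nxt where "nxt j n = (SOME k. n < k \<and> good j n k)" for j n
  have nxt: "n < nxt j n" and good: "good j n (nxt j n)" for j n
    using someI_ex[OF ex[of n j]] by (simp_all add: nxt_def)
  define s where "s = rec_nat 0 nxt"
  have sS: "s (Suc j) = nxt j (s j)" for j by (simp add: s_def)
  have s: "strict_mono s" by (simp add: strict_mono_Suc_iff sS nxt)
  have step: "g j * p v \<le> g (Suc j) * p (v + t *\<^sub>R y (s (Suc j)))" if "p \<in> P j" "v \<in> V j (s j)" for j p v t
  proof -
    have "g j / g (Suc j) * p v \<le> p (v + t *\<^sub>R y (s (Suc j)))"
      using good[of j "s j"] that unfolding good_def sS by blast
    then show ?thesis using g(1)[of "Suc j"] by (simp add: field_simps)
  qed
  have iter: "g j * p v \<le> g (j + q) * p (v + (\<Sum>i<q. a i *\<^sub>R y (s (Suc j + i))))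
      \<and> v + (\<Sum>i<q. a i *\<^sub>R y (s (Suc j + i))) \<in> V (j + q) (s (j + q))"
    if "p \<in> P j" "v \<in> V j (s j)" for j p v a q
  proof (induction q)
    case 0
    then show ?case using that by simp
  next
    case (Suc q)
    let ?v = "v + (\<Sum>i<q. a i *\<^sub>R y (s (Suc j + i)))"
    have "p \<in> P (j + q)" using that(1) by (auto simp: P_def)
    then have "g (j + q) * p ?v \<le> g (Suc (j + q)) * p (?v + a q *\<^sub>R y (s (Suc (j + q))))"
      using Suc by (intro step) auto
    moreover have "V (j + q) (s (j + q)) \<subseteq> V (j + Suc q) (s (j + Suc q))"
      unfolding V_def using s
      by (intro span_mono Un_mono image_mono) (auto simp: strict_mono_less_eq intro: order_trans)
    then have "?v \<in> V (j + Suc q) (s (j + Suc q))" using Suc by blast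
    then have "?v + a q *\<^sub>R y (s (Suc (j + q))) \<in> V (j + Suc q) (s (j + Suc q))"
      unfolding V_def by (elim span_add) (intro span_scale[OF span_base], simp)
    ultimately show ?case using Suc by (auto simp: add.assoc intro: order_trans)
  qed
  interpret s: schreier_blocks e C K "y \<circ> s" "u \<circ> s" "pos \<circ> s" by (rule subsequence[OF s])
  have "schreier_mazur e C K (y \<circ> s) (u \<circ> s) (pos \<circ> s)"
  proof
    fix p :: "'a \<Rightarrow> real" and j v r
    assume "p = norm \<or> (\<exists>m\<le>j. p = tail_gauge m)" and v: "v \<in> span (e ` {..j} \<union> (y \<circ> s) ` {..j})"
      and r: "r \<in> span ((y \<circ> s) ` {j<..})"
    then have p: "p \<in> P j" by (auto simp: P_def)
    have "span (e ` {..j} \<union> (y \<circ> s) ` {..j}) \<subseteq> V j (s j)"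
      unfolding V_def using s by (intro span_mono) (auto simp: strict_mono_less_eq)
    then have v: "v \<in> V j (s j)" using v by blast
    have "(y \<circ> s) ` {j<..} = range (\<lambda>i. y (s (Suc j + i)))"
      by (auto simp: image_iff) (metis Suc_leI le_Suc_ex add_Suc)
    then obtain q and a :: "nat \<Rightarrow> real" where "r = (\<Sum>i<q. a i *\<^sub>R y (s (Suc j + i)))"
      using r span_range_eq_sum by metis
    then have "g j * p v \<le> g (j + q) * p (v + r)" using iter[OF p v] by blast
    moreover have "1 * p v \<le> g j * p v" using g P_nonneg[OF p] by (intro mult_right_mono)
    moreover have "g (j + q) * p (v + r) \<le> 2 * p (v + r)" using g P_nonneg[OF p] by (intro mult_right_mono)
    ultimately show "p v \<le> 2 * p (v + r)" by linarith
  qed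
  with s show thesis by (rule that)
qed

context schreier_mazur
begin

lemma uniform_tail_lift:
  obtains h where "k < h" "\<And>d. d \<in> span (e ` {..k} \<union> y ` {..k}) \<Longrightarrow> tail_gauge k d \<le> R \<Longrightarrow>
    \<exists>x. schreier_le x (R + 1) \<and> (\<forall>n. n < k \<or> h \<le> n \<longrightarrow> x n = 0) \<and>
      norm (d - lincomb e {k..<h} x) \<le> (R + 3) / (real k + 1)"
proof -
  define D where "D = {d \<in> span (e ` {..k} \<union> y ` {..k}). tail_gauge k d \<le> R}"
  define Q where "Q = span (e ` {..k} \<union> y ` {..k}) \<inter> cball 0 ((C + 1) * R)"
  have "D \<subseteq> Q"
  proof
    fix d assume d: "d \<in> D"
    have "norm d \<le> (C + 1) * tail_gauge k d" by (rule tail_gauge_lower)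
    also have "\<dots> \<le> (C + 1) * R" using d C_pos by (intro mult_left_mono) (auto simp: D_def)
    finally show "d \<in> Q" using d by (simp add: D_def Q_def)
  qed
  have "compact Q" unfolding Q_def by (intro compact_span_cball) simp
  define \<rho> where "\<rho> = 1 / (real k + 1)"
  have "0 < \<rho>" by (simp add: \<rho>_def)
  obtain G where G: "finite G" "Q \<subseteq> (\<Union>g\<in>G. ball g \<rho>)"
    using compactE_image[OF \<open>compact Q\<close>, of Q "\<lambda>g. ball g \<rho>"] \<open>0 < \<rho>\<close>
    by (metis UN_I centre_in_ball open_ball subsetI)
  \<comment> \<open>Centres of the net need not belong to \<open>D\<close>, so a nearby
    \<open>d\<close> in \<open>D\<close> is lifted instead. This causes two errors
    \<open>\<rho>\<close>, on top of the lifting error \<open>(R + 1) * \<rho>\<close>.\<close>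
  define good where "good g d x M \<longleftrightarrow> d \<in> D \<and> dist g d < \<rho> \<and> schreier_le x (R + 1) \<and>
      norm (d - lincomb e {k..<M} x) \<le> (R + 1) * \<rho>" for g d x and M :: nat
  have "\<exists>d x M. good g d x M" if g: "\<exists>d\<in>D. dist g d < \<rho>" for g
  proof -
    obtain d where d: "d \<in> D" "dist g d < \<rho>" using g by blast
    then have "tail_gauge k d < R + 1" by (simp add: D_def)
    then obtain s x M where x: "schreier_le x s" "s + (real k + 1) * norm (d - lincomb e {k..<M} x) < R + 1"
      by (rule tail_gauge_less)
    have "0 \<le> s" using x(1) by (rule schreier_le_nonneg)
    then have "(real k + 1) * norm (d - lincomb e {k..<M} x) \<le> R + 1" using x(2) by linarith
    then have "norm (d - lincomb e {k..<M} x) \<le> (R + 1) * \<rho>" by (simp add: \<rho>_def field_simps)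
    moreover have "0 \<le> (real k + 1) * norm (d - lincomb e {k..<M} x)" by simp
    then have "s \<le> R + 1" using x(2) by linarith
    then have "schreier_le x (R + 1)" by (rule schreier_le_mono[OF x(1)])
    ultimately show ?thesis using d by (auto simp: good_def)
  qed
  then obtain d' x' M' where good: "\<And>g. \<exists>d\<in>D. dist g d < \<rho> \<Longrightarrow> good g (d' g) (x' g) (M' g)"
    by metis
  define h where "h = Suc k + (\<Sum>g\<in>G. M' g)"
  show thesis
  proof (rule that[of h])
    show "k < h" by (simp add: h_def)
    fix d assume "d \<in> span (e ` {..k} \<union> y ` {..k})" "tail_gauge k d \<le> R"
    then have d: "d \<in> D" by (simp add: D_def)
    then obtain g where g: "g \<in> G" "dist g d < \<rho>" using G(2) \<open>D \<subseteq> Q\<close> by auto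
    then have gd: "good g (d' g) (x' g) (M' g)" using d good by blast
    have "M' g \<le> h" using member_le_sum[OF g(1), of M'] G(1) by (simp add: h_def)
    define x where "x = restr {k..<M' g} (x' g)"
    have "lincomb e {k..<h} x = lincomb e {k..<M' g} (x' g)"
      unfolding x_def using \<open>M' g \<le> h\<close> by (intro lincomb_restr_subset) auto
    then have "d - lincomb e {k..<h} x = (g - d' g) - (g - d) + (d' g - lincomb e {k..<M' g} (x' g))"
      by simp
    then have "norm (d - lincomb e {k..<h} x)
        \<le> norm (g - d' g) + norm (g - d) + norm (d' g - lincomb e {k..<M' g} (x' g))"
      by (metis (no_types) norm_triangle_le add_right_mono norm_triangle_ineq4)
    also have "\<dots> \<le> \<rho> + \<rho> + (R + 1) * \<rho>"
      using gd g(2) unfolding good_def dist_norm by (intro add_mono) auto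
    also have "\<dots> = (R + 3) * \<rho>" by (simp add: algebra_simps)
    also have "\<dots> = (R + 3) / (real k + 1)" by (simp add: \<rho>_def)
    finally have "norm (d - lincomb e {k..<h} x) \<le> (R + 3) / (real k + 1)" .
    moreover have "schreier_le x (R + 1)" unfolding x_def using gd by (simp add: good_def schreier_le_restr)
    moreover have "\<forall>n. n < k \<or> h \<le> n \<longrightarrow> x n = 0" using \<open>M' g \<le> h\<close> by (auto simp: x_def restr_def)
    ultimately show "\<exists>x. schreier_le x (R + 1) \<and> (\<forall>n. n < k \<or> h \<le> n \<longrightarrow> x n = 0) \<and>
      norm (d - lincomb e {k..<h} x) \<le> (R + 3) / (real k + 1)" by blast
  qed
qed

text \<open>A multiplier turning every bounded lift of \<open>l + r\<close> into a lift of
  \<open>l\<close>, uniformly in all data. The tolerance \<open>1 / (N + 1)\<close> contributes at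
  most 1 to \<open>tail_gauge k\<close> for \<open>k < N\<close>. One scale \<open>n0\<close>,
  \<open>N\<close> serves for coordinates and for indices of \<open>y\<close>.\<close>

definition is_ramp :: "nat \<Rightarrow> nat \<Rightarrow> real \<Rightarrow> (nat \<Rightarrow> real) \<Rightarrow> bool" where
  "is_ramp n0 N \<epsilon> \<phi> \<longleftrightarrow> n0 < N \<and> (\<forall>n. 0 \<le> \<phi> n) \<and> (\<forall>n. \<phi> n \<le> 1) \<and>
     (\<forall>n<n0. \<phi> n = 1) \<and> (\<forall>n\<ge>N. \<phi> n = 0) \<and>
     (\<forall>x M l r. schreier_le x K \<longrightarrow> N \<le> M \<longrightarrow> l \<in> span (y ` {..n0}) \<longrightarrow> r \<in> span (y ` {N..}) \<longrightarrow>
        norm (lincomb e {..<M} x - l - r) \<le> 1 / (real N + 1) \<longrightarrow>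
        norm (lincomb e {..<M} (\<lambda>n. \<phi> n * x n) - l) \<le> \<epsilon>)"

text \<open>A sharp cut of \<open>x\<close> at \<open>k\<close> makes the error \<open>d = T (x restricted to {..<k}) - l\<close>, which is the
  image of a bounded vector supported in \<open>[k, \<infinity>)\<close> because \<open>d - r\<close> is such an image and \<open>r\<close> cannot
  decrease the gauge of \<open>d\<close> much. Averaging cuts at suitable positions therefore makes it small.\<close>

lemma ramp_exists:
  assumes "0 < \<epsilon>"
  shows "\<exists>N \<phi>. is_ramp n0 N \<epsilon> \<phi>"
proof -
  \<comment> \<open>The factor 2 comes from \<open>mazur\<close>, \<open>K\<close> from the bound on
    \<open>x\<close>, and 1 from the tolerance in \<open>is_ramp\<close>.\<close>
  define R where "R = 2 * (K + 1)"
  have "0 \<le> R" using K_pos by (simp add: R_def)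
  have "\<exists>h>k. \<forall>d\<in>span (e ` {..k} \<union> y ` {..k}). tail_gauge k d \<le> R \<longrightarrow>
    (\<exists>x. schreier_le x (R + 1) \<and> (\<forall>n. n < k \<or> h \<le> n \<longrightarrow> x n = 0) \<and>
      norm (d - lincomb e {k..<h} x) \<le> (R + 3) / (real k + 1))" for k
    by (rule uniform_tail_lift[of k R]) blast
  then obtain h where h: "\<And>k. k < h k" "\<And>k d. d \<in> span (e ` {..k} \<union> y ` {..k}) \<Longrightarrow> tail_gauge k d \<le> R \<Longrightarrow>
    \<exists>x. schreier_le x (R + 1) \<and> (\<forall>n. n < k \<or> h k \<le> n \<longrightarrow> x n = 0) \<and>
      norm (d - lincomb e {k..<h k} x) \<le> (R + 3) / (real k + 1)"
    by metis
  obtain k0 :: nat where "(R + 3) / (\<epsilon> / 2) < real k0" using reals_Archimedean2 by blast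
  have k0: "(R + 3) / (real k + 1) \<le> \<epsilon> / 2" if "k0 \<le> k" for k
  proof -
    have "(R + 3) / (\<epsilon> / 2) \<le> real k + 1" using \<open>(R + 3) / (\<epsilon> / 2) < k0\<close> that by linarith
    then show ?thesis using \<open>0 < \<epsilon>\<close> by (simp add: field_simps)
  qed
  \<comment> \<open>Each cut position lies beyond the lifts of the errors at the previous one, so
    these lifts are successive blocks. Starting above \<open>k0\<close> makes the lifting errors at
    most \<open>\<epsilon> / 2\<close>.\<close>
  define \<kappa> where "\<kappa> = rec_nat (k0 + n0 + 1) (\<lambda>_ k. h k)"
  have \<kappa>0: "\<kappa> 0 = k0 + n0 + 1" and \<kappa>S: "\<kappa> (Suc j) = h (\<kappa> j)" for j by (simp_all add: \<kappa>_def)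
  have \<kappa>: "strict_mono \<kappa>" by (simp add: strict_mono_Suc_iff \<kappa>S h)
  then have \<kappa>_mono: "\<kappa> i \<le> \<kappa> j" if "i \<le> j" for i j using that by (simp add: strict_mono_less_eq)
  have \<kappa>_ge: "k0 \<le> \<kappa> j" "n0 < \<kappa> j" for j using \<kappa>_mono[of 0 j] by (simp_all add: \<kappa>0)
  obtain m :: nat and c :: "nat \<Rightarrow> real" where c: "\<And>j. 0 \<le> c j" "(\<Sum>j<m. c j) = 1"
    and small: "\<And>t. (\<And>j n. n < \<kappa> j \<or> \<kappa> (Suc j) \<le> n \<Longrightarrow> t j n = 0) \<Longrightarrow>
      (\<And>j. schreier_le (t j) (R + 1)) \<Longrightarrow> schreier_le (\<lambda>n. \<Sum>j<m. c j * t j n) (\<epsilon> / (2 * C))"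
    by (rule schreier_convex_weights[OF \<kappa>, of "R + 1" "\<epsilon> / (2 * C)"])
      (use \<open>0 \<le> R\<close> C_pos \<open>0 < \<epsilon>\<close> in auto)
  \<comment> \<open>The successor makes every cut position strictly smaller than \<open>N\<close>,
    as needed to apply \<open>mazur\<close> to \<open>r\<close>.\<close>
  define N where "N = Suc (\<kappa> m)"
  \<comment> \<open>The average of the sharp cuts at all \<open>\<kappa> j\<close>. The weights were
    obtained before any \<open>x\<close> is given, so this is a fixed multiplier.\<close>
  define \<phi> where "\<phi> n = (\<Sum>j<m. c j * restr {..<\<kappa> j} (\<lambda>_. 1) n)" for n
  have "is_ramp n0 N \<epsilon> \<phi>"
    unfolding is_ramp_def
  proof (intro conjI allI impI)
    show "n0 < N" using \<kappa>_ge(2)[of m] by (simp add: N_def)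
    show "0 \<le> \<phi> n" for n unfolding \<phi>_def by (intro sum_nonneg mult_nonneg_nonneg c) (simp add: restr_def)
    have "\<phi> n \<le> (\<Sum>j<m. c j)" for n
      unfolding \<phi>_def by (rule sum_mono) (auto simp: restr_def c)
    then show "\<phi> n \<le> 1" for n by (simp add: c(2))
    show "\<phi> n = 1" if "n < n0" for n
    proof -
      have "\<phi> n = (\<Sum>j<m. c j)"
        unfolding \<phi>_def by (rule sum.cong) (use less_trans[OF that \<kappa>_ge(2)] in \<open>auto simp: restr_def\<close>)
      then show ?thesis by (simp add: c(2))
    qed
    show "\<phi> n = 0" if "N \<le> n" for n
      unfolding \<phi>_def
    proof (intro sum.neutral ballI)
      fix j assume "j \<in> {..<m}"
      then show "c j * restr {..<\<kappa> j} (\<lambda>_. 1) n = 0"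
        using \<kappa>_mono[of j m] that by (simp add: restr_def N_def)
    qed
  next
    fix x M l r
    assume x: "schreier_le x K" and M: "N \<le> M" and l: "l \<in> span (y ` {..n0})"
      and r: "r \<in> span (y ` {N..})" and err: "norm (lincomb e {..<M} x - l - r) \<le> 1 / (real N + 1)"
    define d where "d j = lincomb e {..<\<kappa> j} x - l" for j
    have "\<exists>t. schreier_le t (R + 1) \<and> (\<forall>n. n < \<kappa> j \<or> \<kappa> (Suc j) \<le> n \<longrightarrow> t n = 0) \<and>
      (j < m \<longrightarrow> norm (d j - lincomb e {\<kappa> j..<\<kappa> (Suc j)} t) \<le> \<epsilon> / 2)" for j
    proof (cases "j < m")
      case True
      have "\<kappa> j < N" using \<kappa>_mono[of j m] True by (simp add: N_def)
      have span1: "lincomb e {..<\<kappa> j} x \<in> span (e ` {..\<kappa> j} \<union> y ` {..\<kappa> j})"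
        by (rule subsetD[OF span_mono lincomb_in_span]) auto
      have span2: "l \<in> span (e ` {..\<kappa> j} \<union> y ` {..\<kappa> j})"
        by (rule subsetD[OF span_mono l]) (use \<kappa>_ge(2)[of j] in auto)
      have dj: "d j \<in> span (e ` {..\<kappa> j} \<union> y ` {..\<kappa> j})"
        unfolding d_def by (intro span_diff span1 span2)
      have "r \<in> span (y ` {\<kappa> j<..})"
        by (rule subsetD[OF span_mono r]) (use \<open>\<kappa> j < N\<close> in auto)
      then have "- r \<in> span (y ` {\<kappa> j<..})" by (rule span_neg)
      with dj have "tail_gauge (\<kappa> j) (d j) \<le> 2 * tail_gauge (\<kappa> j) (d j + - r)"
        by (intro mazur[of _ "\<kappa> j"]) auto
      \<comment> \<open>Up to the tolerance, the negative of \<open>x\<close> from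
        \<open>\<kappa> j\<close> on lifts \<open>d j - r\<close>.\<close>
      also have "tail_gauge (\<kappa> j) (d j + - r)
          \<le> K + (real (\<kappa> j) + 1) * norm (d j + - r - lincomb e {\<kappa> j..<M} (\<lambda>n. - 1 * x n))"
        by (rule tail_gauge_le) (use schreier_le_cmult[OF x, of "-1"] in simp)
      also have "d j + - r - lincomb e {\<kappa> j..<M} (\<lambda>n. - 1 * x n) = lincomb e {..<M} x - l - r"
        using \<open>\<kappa> j < N\<close> M unfolding d_def lincomb_cmult by (subst (2) lincomb_split[of "\<kappa> j"]) auto
      also have "(real (\<kappa> j) + 1) * norm (lincomb e {..<M} x - l - r) \<le> (real N + 1) * (1 / (real N + 1))"
        using \<open>\<kappa> j < N\<close> by (intro mult_mono err) auto
      also have "\<dots> = 1" by simp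
      finally have "tail_gauge (\<kappa> j) (d j) \<le> R" by (simp add: R_def)
      from h(2)[OF dj this] obtain t where t: "schreier_le t (R + 1)" "\<forall>n. n < \<kappa> j \<or> \<kappa> (Suc j) \<le> n \<longrightarrow> t n = 0"
        "norm (d j - lincomb e {\<kappa> j..<\<kappa> (Suc j)} t) \<le> (R + 3) / (real (\<kappa> j) + 1)"
        by (auto simp: \<kappa>S)
      with k0[OF \<kappa>_ge(1)[of j]] show ?thesis by (blast intro: order_trans)
    next
      case False
      \<comment> \<open>The zero vector pads the family, since \<open>small\<close> expects blocks
        for all \<open>j\<close>.\<close>
      then show ?thesis using \<open>0 \<le> R\<close> by (intro exI[of _ "\<lambda>_. 0"]) (simp add: schreier_le_zero)
    qed
    then obtain t where t: "\<And>j. schreier_le (t j) (R + 1)" "\<And>j n. n < \<kappa> j \<or> \<kappa> (Suc j) \<le> n \<Longrightarrow> t j n = 0"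
      and t_err: "\<And>j. j < m \<Longrightarrow> norm (d j - lincomb e {\<kappa> j..<\<kappa> (Suc j)} (t j)) \<le> \<epsilon> / 2"
      by metis
    let ?L = "lincomb e {..<M}"
    have Lt: "?L (t j) = lincomb e {\<kappa> j..<\<kappa> (Suc j)} (t j)" if "j < m" for j
      by (rule lincomb_mono_neutral) (use t(2)[of _ j] \<kappa>_mono[of "Suc j" m] that M in \<open>auto simp: N_def\<close>)
    have Lx: "?L (restr {..<\<kappa> j} x) = lincomb e {..<\<kappa> j} x" if "j < m" for j
      by (rule lincomb_restr_subset) (use \<kappa>_mono[of j m] that M in \<open>auto simp: N_def\<close>)
    have "(\<lambda>n. \<phi> n * x n) = (\<lambda>n. \<Sum>j<m. c j * restr {..<\<kappa> j} x n)"
      by (auto simp: \<phi>_def sum_distrib_right restr_def fun_eq_iff intro!: sum.cong)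
    then have "?L (\<lambda>n. \<phi> n * x n) - l = (\<Sum>j<m. c j *\<^sub>R lincomb e {..<\<kappa> j} x) - (\<Sum>j<m. c j) *\<^sub>R l"
      by (simp add: lincomb_sum lincomb_cmult Lx c(2))
    also have "\<dots> = (\<Sum>j<m. c j *\<^sub>R d j)"
      by (simp add: d_def scaleR_diff_right sum_subtractf scaleR_sum_left)
    also have "\<dots> = ?L (\<lambda>n. \<Sum>j<m. c j * t j n) + (\<Sum>j<m. c j *\<^sub>R (d j - lincomb e {\<kappa> j..<\<kappa> (Suc j)} (t j)))"
      by (simp add: lincomb_sum lincomb_cmult Lt scaleR_diff_right sum_subtractf)
    finally have eq: "?L (\<lambda>n. \<phi> n * x n) - l
        = ?L (\<lambda>n. \<Sum>j<m. c j * t j n) + (\<Sum>j<m. c j *\<^sub>R (d j - lincomb e {\<kappa> j..<\<kappa> (Suc j)} (t j)))" .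
    have 1: "norm (?L (\<lambda>n. \<Sum>j<m. c j * t j n)) \<le> \<epsilon> / 2"
      using lincomb_bound[of "{..<M}", OF _ small[OF t(2,1)]] C_pos by simp
    have "norm (\<Sum>j<m. c j *\<^sub>R (d j - lincomb e {\<kappa> j..<\<kappa> (Suc j)} (t j))) \<le> (\<Sum>j<m. c j * (\<epsilon> / 2))"
    proof (rule sum_norm_le)
      fix j assume "j \<in> {..<m}"
      then have "c j * norm (d j - lincomb e {\<kappa> j..<\<kappa> (Suc j)} (t j)) \<le> c j * (\<epsilon> / 2)"
        using c(1) t_err by (intro mult_left_mono) auto
      then show "norm (c j *\<^sub>R (d j - lincomb e {\<kappa> j..<\<kappa> (Suc j)} (t j))) \<le> c j * (\<epsilon> / 2)"
        unfolding norm_scaleR using c(1)[of j] by simp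
    qed
    also have "\<dots> = \<epsilon> / 2" unfolding sum_distrib_right[symmetric] c(2) by simp
    finally have 2: "norm (\<Sum>j<m. c j *\<^sub>R (d j - lincomb e {\<kappa> j..<\<kappa> (Suc j)} (t j))) \<le> \<epsilon> / 2" .
    show "norm (?L (\<lambda>n. \<phi> n * x n) - l) \<le> \<epsilon>"
      unfolding eq using norm_triangle_le[OF add_mono[OF 1 2]] by simp
  qed
  then show ?thesis by blast
qed

end

text \<open>The positions \<open>\<iota>\<close> separate the supports of the \<open>u k\<close> and
  also delimit the ramps: \<open>\<phi> k\<close> falls from 1 to 0 between \<open>\<iota> k\<close>
  and \<open>\<iota> (Suc k)\<close> and cuts after the summand with index \<open>k\<close>.\<close>

locale schreier_ramps = schreier_blocks e C K y u \<iota>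
  for e :: "nat \<Rightarrow> 'a::banach" and C K y u \<iota> +
  fixes \<phi> :: "nat \<Rightarrow> nat \<Rightarrow> real"
  assumes basic: "l \<in> span (y ` {..j}) \<Longrightarrow> r \<in> span (y ` {j<..}) \<Longrightarrow> norm l \<le> 2 * norm (l + r)"
    and ramp_nonneg: "0 \<le> \<phi> k n" and ramp_le_1: "\<phi> k n \<le> 1"
    and ramp_eq_1: "n < \<iota> k \<Longrightarrow> \<phi> k n = 1" and ramp_eq_0: "\<iota> (Suc k) \<le> n \<Longrightarrow> \<phi> k n = 0"
    and ramp_cut: "schreier_le x K \<Longrightarrow> \<iota> (Suc k) \<le> M \<Longrightarrow> l \<in> span (y ` {..k}) \<Longrightarrow>
      r \<in> span (y ` {k<..}) \<Longrightarrow> norm (lincomb e {..<M} x - l - r) \<le> 1 / (real (\<iota> (Suc k)) + 1) \<Longrightarrow>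
      norm (lincomb e {..<M} (\<lambda>n. \<phi> k n * x n) - l) \<le> (1/2)^k"

lemma (in schreier_mazur) ramps_subsequence:
  obtains \<iota> \<phi> where "strict_mono \<iota>" "schreier_ramps e C K (y \<circ> \<iota>) (u \<circ> \<iota>) \<iota> \<phi>"
proof -
  \<comment> \<open>The next ramp must start beyond the index \<open>i\<close>, so that
    \<open>y i\<close> is on its left, and beyond the support of \<open>u i\<close>, so that the
    ramp ends are block boundaries too.\<close>
  define \<nu> where "\<nu> i = max i (pos (Suc i))" for i
  define f where "f i k = (SOME z. is_ramp (\<nu> i) (fst z) ((1/2)^k) (snd z))" for i k :: nat
  define N \<Phi> where "N i k = fst (f i k)" and "\<Phi> i k = snd (f i k)" for i k
  have "is_ramp (\<nu> i) (N i k) ((1/2)^k) (\<Phi> i k)" for i k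
  proof -
    have "\<exists>z. is_ramp (\<nu> i) (fst z) ((1/2)^k) (snd z)"
      using ramp_exists[of "(1/2)^k" "\<nu> i"] by simp
    then show ?thesis unfolding N_def \<Phi>_def f_def by (rule someI_ex)
  qed
  then have N: "\<nu> i < N i k"
    and \<Phi>: "0 \<le> \<Phi> i k n" "\<Phi> i k n \<le> 1"
      "n < \<nu> i \<Longrightarrow> \<Phi> i k n = 1" "N i k \<le> n \<Longrightarrow> \<Phi> i k n = 0"
    and cut: "schreier_le x K \<Longrightarrow> N i k \<le> M \<Longrightarrow> l \<in> span (y ` {..\<nu> i}) \<Longrightarrow>
      r \<in> span (y ` {N i k..}) \<Longrightarrow> norm (lincomb e {..<M} x - l - r) \<le> 1 / (real (N i k) + 1) \<Longrightarrow>
      norm (lincomb e {..<M} (\<lambda>n. \<Phi> i k n * x n) - l) \<le> (1/2)^k" for i k n x M l r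
    unfolding is_ramp_def by simp_all
  define \<iota> where "\<iota> = rec_nat 0 (\<lambda>k i. N i k)"
  have \<iota>S: "\<iota> (Suc k) = N (\<iota> k) k" for k by (simp add: \<iota>_def)
  have \<nu>_less: "\<nu> (\<iota> k) < \<iota> (Suc k)" for k using N by (simp add: \<iota>S)
  then have "\<iota> k < \<iota> (Suc k)" for k by (metis \<nu>_def max.strict_boundedE)
  then have \<iota>: "strict_mono \<iota>" by (simp add: strict_mono_Suc_iff)
  interpret s: schreier_blocks e C K "y \<circ> \<iota>" "u \<circ> \<iota>" "pos \<circ> \<iota>" by (rule subsequence[OF \<iota>])
  have pos_ge: "i \<le> pos i" for i using pos by (rule strict_mono_imp_increasing)
  have pos_le: "pos (Suc (\<iota> k)) \<le> \<iota> (Suc k)" for k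
    using \<nu>_less[of k] by (simp add: \<nu>_def)
  have "schreier_ramps e C K (y \<circ> \<iota>) (u \<circ> \<iota>) \<iota> (\<lambda>k. \<Phi> (\<iota> k) k)"
  proof
    show "strict_mono \<iota>" by (rule \<iota>)
  next
    fix n k assume "n < \<iota> k \<or> \<iota> (Suc k) \<le> n"
    then show "(u \<circ> \<iota>) k n = 0"
      using u_supp[of n "\<iota> k"] pos_ge[of "\<iota> k"] pos_le[of k] by auto
  next
    fix k
    have "lincomb e {..<\<iota> (Suc k)} (u (\<iota> k)) = lincomb e {..<pos (Suc (\<iota> k))} (u (\<iota> k))"
      by (rule lincomb_mono_neutral) (use pos_le[of k] u_supp[of _ "\<iota> k"] in auto)
    moreover have "(1/2::real)^(\<iota> k) \<le> (1/2)^k"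
      using \<iota> by (intro power_decreasing) (auto intro: strict_mono_imp_increasing)
    ultimately show "norm ((y \<circ> \<iota>) k - lincomb e {..<\<iota> (Suc k)} ((u \<circ> \<iota>) k)) \<le> (1/2)^k"
      using order_trans[OF u_err[of "\<iota> k"]] by simp
  next
    fix l r j assume l: "l \<in> span ((y \<circ> \<iota>) ` {..j})" and r: "r \<in> span ((y \<circ> \<iota>) ` {j<..})"
    have "l \<in> span (e ` {..\<iota> j} \<union> y ` {..\<iota> j})"
      by (rule subsetD[OF span_mono l]) (use \<iota> in \<open>auto simp: strict_mono_less_eq\<close>)
    moreover have "r \<in> span (y ` {\<iota> j<..})"
      by (rule subsetD[OF span_mono r]) (use \<iota> in \<open>auto simp: strict_mono_less\<close>)
    ultimately show "norm l \<le> 2 * norm (l + r)" by (intro mazur) auto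
  next
    fix n k assume "n < \<iota> k"
    then show "\<Phi> (\<iota> k) k n = 1" by (intro \<Phi>) (simp add: \<nu>_def)
  next
    fix n k assume "\<iota> (Suc k) \<le> n"
    then show "\<Phi> (\<iota> k) k n = 0" by (intro \<Phi>) (simp add: \<iota>S)
  next
    fix x k M l r
    assume x: "schreier_le x K" and M: "\<iota> (Suc k) \<le> M" and l: "l \<in> span ((y \<circ> \<iota>) ` {..k})"
      and r: "r \<in> span ((y \<circ> \<iota>) ` {k<..})"
      and err: "norm (lincomb e {..<M} x - l - r) \<le> 1 / (real (\<iota> (Suc k)) + 1)"
    have "\<iota> i \<le> \<nu> (\<iota> k)" if "i \<le> k" for i
      using \<iota> that by (auto simp: strict_mono_less_eq \<nu>_def intro: max.coboundedI1)
    then have l': "l \<in> span (y ` {..\<nu> (\<iota> k)})"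
      by (intro subsetD[OF span_mono l]) auto
    have "\<iota> (Suc k) \<le> \<iota> i" if "k < i" for i using \<iota> that by (simp add: strict_mono_less_eq Suc_leI)
    then have r': "r \<in> span (y ` {N (\<iota> k) k..})"
      by (intro subsetD[OF span_mono r]) (auto simp: \<iota>S)
    show "norm (lincomb e {..<M} (\<lambda>n. \<Phi> (\<iota> k) k n * x n) - l) \<le> (1/2)^k"
      using cut[OF x _ l' r'] M err by (simp add: \<iota>S)
  qed (use s.y_ge s.y_le s.u_le \<Phi> in auto)
  with \<iota> show thesis by (rule that)
qed

subsection \<open>Lifts with small coordinates\<close>

context schreier_ramps
begin

definition small_lift :: "real \<Rightarrow> 'a \<Rightarrow> nat \<Rightarrow> nat \<Rightarrow> (nat \<Rightarrow> real) \<Rightarrow> bool" where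
  "small_lift \<eta> w lo hi v \<longleftrightarrow> schreier_le v (K + 1) \<and> (\<forall>n. \<bar>v n\<bar> \<le> \<eta>) \<and>
     (\<forall>n. n < lo \<or> hi \<le> n \<longrightarrow> v n = 0) \<and> norm (w - lincomb e {..<hi} v) \<le> \<eta>"

text \<open>The next ramp is still 1 until \<open>\<iota> (Suc k)\<close>, where this one has
  reached 0. Hence differences of consecutive ramps are nonnegative weights.\<close>

lemma ramp_step_le: "\<phi> k n \<le> \<phi> (Suc k) n"
  using ramp_eq_0[of k n] ramp_eq_1[of n "Suc k"] ramp_nonneg[of "Suc k" n] ramp_le_1[of k n]
  by (cases "n < \<iota> (Suc k)") auto

text \<open>Two consecutive ramps produce lifts of two consecutive partial sums, with errors
  \<open>(1/2)^k\<close> and \<open>(1/2)^(k - 1)\<close>, which add up to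
  \<open>3 * (1/2)^k\<close>.\<close>

lemma cut_pieces:
  assumes x: "schreier_le x K" and M: "\<iota> b \<le> M" and "0 < a"
    and err: "norm (lincomb e {..<M} x - (\<Sum>k=a..<b. c k *\<^sub>R y k)) \<le> 1 / (real (\<iota> b) + 1)"
    and k: "a \<le> k" "k < b"
  shows "norm (c k *\<^sub>R y k - lincomb e {..<\<iota> b} (\<lambda>n. (\<phi> k n - \<phi> (k - 1) n) * x n)) \<le> 3 * (1/2)^k"
proof -
  let ?L = "lincomb e {..<\<iota> b}"
  define l where "l j = (\<Sum>i=a..<Suc j. c i *\<^sub>R y i)" for j
  \<comment> \<open>The condition \<open>a \<le> Suc j\<close> admits \<open>j = a - 1\<close>,
    where \<open>l j\<close> is the empty sum; \<open>0 < a\<close> makes this a genuine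
    predecessor.\<close>
  have cut: "norm (?L (\<lambda>n. \<phi> j n * x n) - l j) \<le> (1/2)^j" if j: "a \<le> Suc j" "j < b" for j
  proof -
    define r where "r = (\<Sum>i=Suc j..<b. c i *\<^sub>R y i)"
    have w: "(\<Sum>k=a..<b. c k *\<^sub>R y k) = l j + r"
      unfolding l_def r_def using j by (intro sum.atLeastLessThan_concat[symmetric]) auto
    have "l j \<in> span (y ` {..j})" unfolding l_def by (intro span_sum span_scale[OF span_base]) auto
    moreover have "r \<in> span (y ` {j<..})" unfolding r_def by (intro span_sum span_scale[OF span_base]) auto
    moreover have "\<iota> (Suc j) \<le> \<iota> b" using j by (intro pos_mono) auto
    moreover have "norm (lincomb e {..<M} x - l j - r) \<le> 1 / (real (\<iota> (Suc j)) + 1)"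
    proof -
      have "norm (lincomb e {..<M} x - l j - r) \<le> 1 / (real (\<iota> b) + 1)"
        using err by (simp add: w diff_diff_eq)
      also have "\<dots> \<le> 1 / (real (\<iota> (Suc j)) + 1)"
        using \<open>\<iota> (Suc j) \<le> \<iota> b\<close> by (intro divide_left_mono) auto
      finally show ?thesis .
    qed
    ultimately have "norm (lincomb e {..<M} (\<lambda>n. \<phi> j n * x n) - l j) \<le> (1/2)^j"
      using x M by (intro ramp_cut) auto
    moreover have "lincomb e {..<M} (\<lambda>n. \<phi> j n * x n) = ?L (\<lambda>n. \<phi> j n * x n)"
      by (rule lincomb_mono_neutral) (use M \<open>\<iota> (Suc j) \<le> \<iota> b\<close> ramp_eq_0[of j] in auto)
    ultimately show ?thesis by simp
  qed
  have Suc: "Suc (k - 1) = k" using k(1) \<open>0 < a\<close> by simp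
  have "l k = l (k - 1) + c k *\<^sub>R y k" unfolding l_def Suc using k(1) by simp
  moreover have "?L (\<lambda>n. (\<phi> k n - \<phi> (k - 1) n) * x n) = ?L (\<lambda>n. \<phi> k n * x n) - ?L (\<lambda>n. \<phi> (k - 1) n * x n)"
    unfolding lincomb_diff[symmetric] by (simp add: left_diff_distrib)
  ultimately have "c k *\<^sub>R y k - ?L (\<lambda>n. (\<phi> k n - \<phi> (k - 1) n) * x n)
      = (?L (\<lambda>n. \<phi> (k - 1) n * x n) - l (k - 1)) - (?L (\<lambda>n. \<phi> k n * x n) - l k)"
    by simp
  then have "norm (c k *\<^sub>R y k - ?L (\<lambda>n. (\<phi> k n - \<phi> (k - 1) n) * x n))
      \<le> norm (?L (\<lambda>n. \<phi> (k - 1) n * x n) - l (k - 1)) + norm (?L (\<lambda>n. \<phi> k n * x n) - l k)"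
    by (simp only: norm_triangle_ineq4)
  also have "\<dots> \<le> (1/2)^(k - 1) + (1/2)^k"
    using k Suc by (intro add_mono cut) auto
  also have "(1/2::real)^(k - 1) = 2 * (1/2)^k"
    using power_Suc[of "1/2::real" "k - 1"] unfolding Suc by simp
  finally show ?thesis by simp
qed

text \<open>Cut a bounded lift of \<open>w\<close> into pieces lifting \<open>c k *\<^sub>R y k\<close>. Only boundedly many pieces have a
  large coordinate, and these may be replaced by \<open>c k\<close> times \<open>u k\<close>, which is tiny.\<close>

lemma small_lift_exists:
  assumes \<eta>: "0 < \<eta>" "\<eta> \<le> 1"
  obtains \<delta> a0 where "0 < \<delta>" "\<forall>a\<ge>a0. \<forall>b c. (\<forall>k\<in>{a..<b}. \<bar>c k\<bar> \<le> \<delta>) \<longrightarrow>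
    norm (\<Sum>k=a..<b. c k *\<^sub>R y k) \<le> 1 \<longrightarrow> (\<exists>v. small_lift \<eta> (\<Sum>k=a..<b. c k *\<^sub>R y k) (\<iota> (a - 1)) (\<iota> b) v)"
proof -
  \<comment> \<open>At most \<open>8 * K / \<eta>\<close> pieces are replaced, each at cost
    \<open>\<delta> * (2 * K)\<close>, and the total must not exceed \<open>\<eta> / 2\<close>. The
    bound 1 controls the lifting errors of the replacements.\<close>
  define \<delta> where "\<delta> = min 1 (\<eta>^2 / (32 * K^2))"
  have \<delta>: "0 < \<delta>" "\<delta> \<le> 1" "32 * K^2 * \<delta> \<le> \<eta>^2"
    using \<eta> K_pos by (auto simp: \<delta>_def min_def field_simps)
  \<comment> \<open>The errors \<open>3 * (1/2)^k\<close> with \<open>k \<ge> a\<close> sum to at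
    most \<open>6 * (1/2)^a\<close>.\<close>
  obtain a1 where a1: "(1/2::real)^a1 < \<eta> / 6" using real_arch_pow_inv[of "\<eta> / 6" "1/2"] \<eta> by auto
  show thesis
  proof (rule that[of \<delta> "Suc a1"], rule \<delta>(1), intro allI impI)
    fix a b and c :: "nat \<Rightarrow> real" assume a: "Suc a1 \<le> a" and "\<forall>k\<in>{a..<b}. \<bar>c k\<bar> \<le> \<delta>"
    then have c: "\<bar>c k\<bar> \<le> \<delta>" if "a \<le> k" "k < b" for k using that by simp
    define w where "w = (\<Sum>k=a..<b. c k *\<^sub>R y k)"
    assume "norm (\<Sum>k=a..<b. c k *\<^sub>R y k) \<le> 1"
    then have w1: "norm w \<le> 1" by (simp add: w_def)
    obtain x' M' where x': "schreier_le x' (K * norm w)" "norm (w - lincomb e {..<M'} x') < 1 / (real (\<iota> b) + 1)"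
      using lift[of "1 / (real (\<iota> b) + 1)" w] by auto
    define x where "x = restr {..<M'} x'"
    define M where "M = max M' (\<iota> b)"
    have x: "schreier_le x K"
      unfolding x_def using K_pos w1 by (intro schreier_le_restr schreier_le_mono[OF x'(1)]) (simp add: mult_le_cancel_left1)
    have "lincomb e {..<M} x = lincomb e {..<M'} x'"
      unfolding x_def by (rule lincomb_restr_subset) (auto simp: M_def)
    then have err: "norm (lincomb e {..<M} x - w) \<le> 1 / (real (\<iota> b) + 1)"
      using x'(2) by (simp add: norm_minus_commute)
    define \<psi> where "\<psi> k n = \<phi> k n - \<phi> (k - 1) n" for k n
    have \<psi>_nonneg: "0 \<le> \<psi> k n" if "a \<le> k" for k n
      using ramp_step_le[of "k - 1" n] that a by (simp add: \<psi>_def)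
    have \<psi>_supp: "\<iota> (k - 1) \<le> n \<and> n < \<iota> (Suc k)" if "\<psi> k n \<noteq> 0" for k n
    proof -
      have "\<psi> k n = 0" if "n < \<iota> (k - 1)"
        using that pos_mono[of "k - 1" k] ramp_eq_1[of n k] ramp_eq_1[of n "k - 1"] by (simp add: \<psi>_def)
      moreover have "\<psi> k n = 0" if "\<iota> (Suc k) \<le> n"
        using that pos_mono[of "Suc (k - 1)" "Suc k"] ramp_eq_0[of k n] ramp_eq_0[of "k - 1" n] by (simp add: \<psi>_def)
      ultimately show ?thesis using that by (meson not_le)
    qed
    have \<psi>_sum: "(\<Sum>k=a..<b. \<psi> k n) \<le> 1" for n
    proof (cases "a \<le> b")
      case True
      then have "(\<Sum>k=a..<b. \<psi> k n) = \<phi> (b - 1) n - \<phi> (a - 1) n"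
      proof (induction b rule: dec_induct)
        case (step m)
        then show ?case using a by (simp add: \<psi>_def)
      qed simp
      then show ?thesis using ramp_le_1[of "b - 1" n] ramp_nonneg[of "a - 1" n] by simp
    qed simp
    define F where "F = {n. n < \<iota> b \<and> \<eta> / 2 < \<bar>x n\<bar>}"
    have "finite F" by (simp add: F_def)
    define bad where "bad = {k \<in> {a..<b}. \<exists>n\<in>F. \<psi> k n \<noteq> 0}"
    define good where "good = {a..<b} - bad"
    have fin: "finite bad" "finite good" by (simp_all add: bad_def good_def)
    have disj: "{a..<b} = good \<union> bad" "good \<inter> bad = {}" by (auto simp: bad_def good_def)
    \<comment> \<open>Only neighbouring pieces overlap, so a large coordinate spoils at most two of
      them.\<close>
    have card2: "card {k \<in> {a..<b}. \<psi> k n \<noteq> 0} \<le> 2" for n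
    proof (cases "{k \<in> {a..<b}. \<psi> k n \<noteq> 0} = {}")
      case False
      define k0 where "k0 = Min {k \<in> {a..<b}. \<psi> k n \<noteq> 0}"
      have k0: "k0 \<in> {k \<in> {a..<b}. \<psi> k n \<noteq> 0}" unfolding k0_def using False by (intro Min_in) auto
      have "{k \<in> {a..<b}. \<psi> k n \<noteq> 0} \<subseteq> {k0, Suc k0}"
      proof
        fix k assume k: "k \<in> {k \<in> {a..<b}. \<psi> k n \<noteq> 0}"
        then have "k0 \<le> k" unfolding k0_def by (intro Min_le) auto
        moreover have "\<not> Suc k0 < k"
        proof
          assume "Suc k0 < k"
          then have "\<iota> (Suc k0) \<le> \<iota> (k - 1)" by (intro pos_mono) auto
          then show False using \<psi>_supp[of k n] \<psi>_supp[of k0 n] k k0 by auto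
        qed
        ultimately show "k \<in> {k0, Suc k0}" by auto
      qed
      then have "card {k \<in> {a..<b}. \<psi> k n \<noteq> 0} \<le> card {k0, Suc k0}" by (intro card_mono) auto
      then show ?thesis by simp
    next
      case True
      then show ?thesis by (simp only: True card.empty)
    qed
    have "bad = (\<Union>n\<in>F. {k \<in> {a..<b}. \<psi> k n \<noteq> 0})" by (auto simp: bad_def)
    then have "card bad \<le> (\<Sum>n\<in>F. card {k \<in> {a..<b}. \<psi> k n \<noteq> 0})"
      using card_UN_le[OF \<open>finite F\<close>] by simp
    also have "\<dots> \<le> (\<Sum>n\<in>F. 2)" by (rule sum_mono) (rule card2)
    finally have "real (card bad) \<le> 2 * real (card F)" by simp
    also have "real (card F) \<le> 2 * K / (\<eta> / 2)"
      using schreier_le_card_large[OF x _ \<open>finite F\<close>, of "\<eta> / 2"] \<eta> by (simp add: F_def)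
    finally have card_bad: "real (card bad) \<le> 8 * K / \<eta>" by simp
    \<comment> \<open>Together the good pieces multiply \<open>x\<close> by a factor between 0 and
      1, so the bound \<open>K\<close> survives no matter how many pieces are removed.\<close>
    define v1 where "v1 n = (\<Sum>k\<in>good. \<psi> k n * x n)" for n
    define v2 where "v2 n = (\<Sum>k\<in>bad. c k * u k n)" for n
    have good_sum: "0 \<le> (\<Sum>k\<in>good. \<psi> k n)" "(\<Sum>k\<in>good. \<psi> k n) \<le> 1" for n
    proof -
      show "0 \<le> (\<Sum>k\<in>good. \<psi> k n)" using \<psi>_nonneg by (intro sum_nonneg) (auto simp: good_def)
      have "(\<Sum>k\<in>good. \<psi> k n) \<le> (\<Sum>k=a..<b. \<psi> k n)"
        using \<psi>_nonneg by (intro sum_mono2) (auto simp: good_def)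
      then show "(\<Sum>k\<in>good. \<psi> k n) \<le> 1" using \<psi>_sum[of n] by linarith
    qed
    have v1_le: "\<bar>v1 n\<bar> \<le> \<bar>x n\<bar>" for n
    proof -
      have "\<bar>v1 n\<bar> = (\<Sum>k\<in>good. \<psi> k n) * \<bar>x n\<bar>"
        using good_sum(1)[of n] by (simp add: v1_def sum_distrib_right[symmetric] abs_mult)
      then show ?thesis using good_sum[of n] by (simp add: mult_left_le_one_le)
    qed
    have v1: "schreier_le v1 K" by (rule schreier_le_dominated[OF x v1_le]) simp
    have v1_abs: "\<bar>v1 n\<bar> \<le> \<eta> / 2" for n
    proof (cases "\<exists>k\<in>good. \<psi> k n \<noteq> 0")
      case True
      then obtain k where k: "k \<in> good" "\<psi> k n \<noteq> 0" by blast
      then have "n \<notin> F" by (auto simp: good_def bad_def)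
      moreover have "\<iota> (Suc k) \<le> \<iota> b" using k by (intro pos_mono) (auto simp: good_def)
      then have "n < \<iota> b" using \<psi>_supp[OF k(2)] by linarith
      ultimately have "\<bar>x n\<bar> \<le> \<eta> / 2" by (auto simp: F_def)
      then show ?thesis using v1_le[of n] by linarith
    next
      case False
      then have "v1 n = 0" by (simp add: v1_def)
      then show ?thesis using \<eta> by simp
    qed
    have "schreier_le v2 (\<Sum>k\<in>bad. \<bar>c k\<bar> * (2 * K))"
      unfolding v2_def by (intro schreier_le_sum schreier_le_cmult u_le)
    moreover have "(\<Sum>k\<in>bad. \<bar>c k\<bar> * (2 * K)) \<le> (\<Sum>k\<in>bad. \<delta> * (2 * K))"
      using c K_pos by (intro sum_mono mult_right_mono) (auto simp: bad_def)
    moreover have "(\<Sum>k\<in>bad. \<delta> * (2 * K)) \<le> \<eta> / 2"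
    proof -
      have "(\<Sum>k\<in>bad. \<delta> * (2 * K)) \<le> 8 * K / \<eta> * (\<delta> * (2 * K))"
        unfolding sum_constant using card_bad \<delta>(1) K_pos by (intro mult_right_mono) auto
      also have "\<dots> = (32 * K^2 * \<delta>) / (2 * \<eta>)" by (simp add: power2_eq_square)
      also have "\<dots> \<le> \<eta>^2 / (2 * \<eta>)" using \<delta> \<eta> by (intro divide_right_mono) auto
      also have "\<dots> = \<eta> / 2" using \<eta> by (simp add: power2_eq_square)
      finally show ?thesis .
    qed
    ultimately have v2: "schreier_le v2 (\<eta> / 2)" by (auto elim: schreier_le_mono)
    have "small_lift \<eta> w (\<iota> (a - 1)) (\<iota> b) (\<lambda>n. v1 n + v2 n)"
      unfolding small_lift_def
    proof (intro conjI allI impI)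
      show "schreier_le (\<lambda>n. v1 n + v2 n) (K + 1)"
        by (rule schreier_le_mono[OF schreier_le_add[OF v1 v2]]) (use \<eta> in simp)
      show "\<bar>v1 n + v2 n\<bar> \<le> \<eta>" for n
        using v1_abs[of n] schreier_le_abs[OF v2, of n] by linarith
    next
      fix n assume n: "n < \<iota> (a - 1) \<or> \<iota> b \<le> n"
      have "\<psi> k n = 0 \<and> u k n = 0" if "k \<in> {a..<b}" for k
      proof
        have "\<iota> (a - 1) \<le> \<iota> (k - 1)" "\<iota> (a - 1) \<le> \<iota> k" "\<iota> (Suc k) \<le> \<iota> b"
          using that by (auto intro!: pos_mono)
        then have n': "n < \<iota> (k - 1) \<or> \<iota> (Suc k) \<le> n" "n < \<iota> k \<or> \<iota> (Suc k) \<le> n" using n by linarith+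
        show "\<psi> k n = 0" using \<psi>_supp[of k n] n'(1) by linarith
        show "u k n = 0" using n'(2) by (rule u_supp)
      qed
      then show "v1 n + v2 n = 0" by (auto simp: v1_def v2_def good_def bad_def)
    next
      let ?L = "lincomb e {..<\<iota> b}"
      \<comment> \<open>The error of the \<open>k\<close>-th piece, which is a ramp piece of
        \<open>x\<close> if good and a multiple of \<open>u k\<close> otherwise.\<close>
      define d where "d k = c k *\<^sub>R y k - (if k \<in> good then ?L (\<lambda>n. \<psi> k n * x n) else c k *\<^sub>R ?L (u k))" for k
      have "norm (d k) \<le> 3 * (1/2)^k" if k: "k \<in> {a..<b}" for k
      proof (cases "k \<in> good")
        case True
        then show ?thesis
          unfolding d_def \<psi>_def using cut_pieces[OF x _ _ err[unfolded w_def]] k a by (simp add: M_def)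
      next
        case False
        have "?L (u k) = lincomb e {..<\<iota> (Suc k)} (u k)"
          by (rule lincomb_mono_neutral) (use k pos_mono[of "Suc k" b] u_supp[of _ k] in auto)
        then have "norm (d k) = \<bar>c k\<bar> * norm (y k - lincomb e {..<\<iota> (Suc k)} (u k))"
          using False unfolding d_def by (simp flip: scaleR_diff_right)
        also have "\<dots> \<le> 1 * (1/2)^k"
          using c[of k] k \<delta>(2) by (intro mult_mono u_err) auto
        also have "\<dots> \<le> 3 * (1/2)^k" by simp
        finally show ?thesis .
      qed
      then have "norm (\<Sum>k=a..<b. d k) \<le> (\<Sum>k=a..<b. 3 * (1/2)^k)" by (rule sum_norm_le)
      also have "\<dots> \<le> 6 * (1/2)^a"
      proof (cases "a \<le> b")
        case True
        then have "(\<Sum>k=a..<b. 3 * (1/2::real)^k) = 6 * (1/2)^a - 6 * (1/2)^b"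
          by (induction b rule: dec_induct) auto
        then show ?thesis by simp
      qed simp
      also have "\<dots> \<le> 6 * (1/2)^a1" using a by (intro mult_left_mono power_decreasing) auto
      also have "\<dots> \<le> \<eta>" using a1 by simp
      finally have "norm (\<Sum>k=a..<b. d k) \<le> \<eta>" .
      moreover have "w - ?L (\<lambda>n. v1 n + v2 n) = (\<Sum>k=a..<b. d k)"
      proof -
        have "?L (\<lambda>n. v1 n + v2 n) = (\<Sum>k\<in>good. ?L (\<lambda>n. \<psi> k n * x n)) + (\<Sum>k\<in>bad. c k *\<^sub>R ?L (u k))"
          unfolding v1_def v2_def lincomb_add lincomb_sum lincomb_cmult ..
        also have "\<dots> = (\<Sum>k\<in>good. if k \<in> good then ?L (\<lambda>n. \<psi> k n * x n) else c k *\<^sub>R ?L (u k))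
            + (\<Sum>k\<in>bad. if k \<in> good then ?L (\<lambda>n. \<psi> k n * x n) else c k *\<^sub>R ?L (u k))"
          using disj(2) by (intro arg_cong2[where f = "(+)"] sum.cong) auto
        also have "\<dots> = (\<Sum>k=a..<b. if k \<in> good then ?L (\<lambda>n. \<psi> k n * x n) else c k *\<^sub>R ?L (u k))"
          unfolding disj(1) using fin disj(2) by (simp add: sum.union_disjoint)
        finally show ?thesis unfolding w_def d_def by (simp add: sum_subtractf)
      qed
      ultimately show "norm (w - ?L (\<lambda>n. v1 n + v2 n)) \<le> \<eta>" by simp
    qed
    then show "\<exists>v. small_lift \<eta> (\<Sum>k=a..<b. c k *\<^sub>R y k) (\<iota> (a - 1)) (\<iota> b) v"
      unfolding w_def by blast
  qed
qed

end

subsection \<open>Copies of the space of null sequences\<close>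

text \<open>A summand is a difference of two partial sums, each at most twice the whole sum in norm;
  with \<open>1/2 \<le> norm (w i)\<close> this gives 1/8.\<close>

lemma (in schreier_ramps) basic_block_coefficient:
  assumes lo: "strict_mono lo" and w: "\<And>j. w j \<in> span (y ` {lo j..<lo (Suc j)})" "\<And>j. 1/2 \<le> norm (w j)"
    and "i < m"
  shows "1/8 * \<bar>b i\<bar> \<le> norm (\<Sum>j<m. b j *\<^sub>R w j)"
proof -
  let ?S = "\<Sum>j<m. b j *\<^sub>R w j"
  have lo_mono: "lo p \<le> lo q" if "p \<le> q" for p q using lo that by (simp add: strict_mono_less_eq)
  have partial: "norm (\<Sum>j<q. b j *\<^sub>R w j) \<le> 2 * norm ?S" if q: "q \<le> m" for q
  proof (cases q)
    case (Suc q')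
    have "0 < lo q" using strict_monoD[OF lo, of q' q] Suc by simp
    have "w j \<in> span (y ` {..lo q - 1})" if "j < q" for j
      by (rule subsetD[OF span_mono w(1)]) (use lo_mono[of "Suc j" q] that \<open>0 < lo q\<close> in auto)
    then have l: "(\<Sum>j<q. b j *\<^sub>R w j) \<in> span (y ` {..lo q - 1})"
      by (intro span_sum span_scale) auto
    have "w j \<in> span (y ` {lo q - 1<..})" if "q \<le> j" for j
      by (rule subsetD[OF span_mono w(1)]) (use lo_mono[OF that] \<open>0 < lo q\<close> in auto)
    then have r: "(\<Sum>j=q..<m. b j *\<^sub>R w j) \<in> span (y ` {lo q - 1<..})"
      by (intro span_sum span_scale) auto
    have "?S = (\<Sum>j<q. b j *\<^sub>R w j) + (\<Sum>j=q..<m. b j *\<^sub>R w j)"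
      unfolding lessThan_atLeast0 using q by (intro sum.atLeastLessThan_concat[symmetric]) auto
    then show ?thesis using basic[OF l r] by simp
  qed simp
  have "\<bar>b i\<bar> * (1/2) \<le> \<bar>b i\<bar> * norm (w i)" using w(2) by (intro mult_left_mono) auto
  also have "\<dots> = norm ((\<Sum>j<Suc i. b j *\<^sub>R w j) - (\<Sum>j<i. b j *\<^sub>R w j))" by simp
  also have "\<dots> \<le> norm (\<Sum>j<Suc i. b j *\<^sub>R w j) + norm (\<Sum>j<i. b j *\<^sub>R w j)" by (rule norm_triangle_ineq4)
  also have "\<dots> \<le> 2 * norm ?S + 2 * norm ?S" using \<open>i < m\<close> by (intro add_mono partial) auto
  finally show ?thesis by simp
qed

text \<open>If the \<open>y k\<close> themselves do not satisfy an upper \<open>c\<^sub>0\<close>-estimate, then there are normalized blocks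
  with arbitrarily small coefficients; these have lifts with arbitrarily small coordinates.\<close>

lemma (in schreier_ramps) c0_blocks:
  obtains lo w B where "strict_mono lo" "\<And>j. w j \<in> span (y ` {lo j..<lo (Suc j)})"
    "\<And>j. 1/2 \<le> norm (w j)"
    "\<forall>m b. (\<forall>j<m. \<bar>b j\<bar> \<le> 1) \<longrightarrow> norm (\<Sum>j<m. b j *\<^sub>R w j) \<le> B"
proof (cases "\<exists>\<delta>>0. \<exists>a. \<forall>b c. (\<forall>k\<in>{a..<b}. \<bar>c k\<bar> \<le> \<delta>) \<longrightarrow> norm (\<Sum>k=a..<b. c k *\<^sub>R y k) \<le> 1")
  case True
  then obtain \<delta> a where \<delta>: "0 < \<delta>"
    and upper: "\<And>b c. (\<And>k. k \<in> {a..<b} \<Longrightarrow> \<bar>c k\<bar> \<le> \<delta>) \<Longrightarrow> norm (\<Sum>k=a..<b. c k *\<^sub>R y k) \<le> 1"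
    by blast
  show thesis
  proof (rule that[of "\<lambda>j. a + j" "\<lambda>j. y (a + j)" "1 / \<delta>"])
    show "strict_mono (\<lambda>j. a + j)" by (simp add: strict_mono_def)
    show "y (a + j) \<in> span (y ` {a + j..<a + Suc j})" for j by (intro span_base) auto
    show "1/2 \<le> norm (y (a + j))" for j by (rule y_ge)
  next
    show "\<forall>m b. (\<forall>j<m. \<bar>b j\<bar> \<le> 1) \<longrightarrow> norm (\<Sum>j<m. b j *\<^sub>R y (a + j)) \<le> 1 / \<delta>"
    proof (intro allI impI)
      fix m and b :: "nat \<Rightarrow> real" assume b: "\<forall>j<m. \<bar>b j\<bar> \<le> 1"
      have "norm (\<Sum>k=a..<a + m. (\<delta> * b (k - a)) *\<^sub>R y k) \<le> 1"
        using b \<delta> by (intro upper) (auto simp: abs_mult mult_le_cancel_left1)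
      also have "(\<Sum>k=a..<a + m. (\<delta> * b (k - a)) *\<^sub>R y k) = (\<Sum>j<m. (\<delta> * b j) *\<^sub>R y (a + j))"
        using sum.shift_bounds_nat_ivl[of "\<lambda>k. (\<delta> * b (k - a)) *\<^sub>R y k" 0 a m]
        by (simp add: lessThan_atLeast0 add.commute)
      also have "\<dots> = \<delta> *\<^sub>R (\<Sum>j<m. b j *\<^sub>R y (a + j))" by (simp add: scaleR_sum_right)
      finally show "norm (\<Sum>j<m. b j *\<^sub>R y (a + j)) \<le> 1 / \<delta>" using \<delta> by (simp add: field_simps)
    qed
  qed
next
  case False
  \<comment> \<open>The same bounds \<open>a\<close>, \<open>q\<close> serve for the indices of
    \<open>y\<close> and the coordinates of the lift, which is possible because
    \<open>k \<le> \<iota> k\<close>.\<close>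
  define step where "step \<eta> a q w v \<longleftrightarrow> a < q \<and> w \<in> span (y ` {a..<q}) \<and> norm w = 1 \<and> small_lift \<eta> w a q v"
    for \<eta> a q w v
  have step_ex: "\<exists>q w v. step \<eta> a q w v" if \<eta>: "0 < \<eta>" "\<eta> \<le> 1" for \<eta> a
  proof -
    obtain \<delta> a0 where \<delta>: "0 < \<delta>" and small: "\<forall>a\<ge>a0. \<forall>b c. (\<forall>k\<in>{a..<b}. \<bar>c k\<bar> \<le> \<delta>) \<longrightarrow>
      norm (\<Sum>k=a..<b. c k *\<^sub>R y k) \<le> 1 \<longrightarrow> (\<exists>v. small_lift \<eta> (\<Sum>k=a..<b. c k *\<^sub>R y k) (\<iota> (a - 1)) (\<iota> b) v)"
      by (rule small_lift_exists[OF \<eta>])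
    \<comment> \<open>\<open>Suc a\<close> compensates for the predecessor in
      \<open>\<iota> (a' - 1)\<close>, where the support of the lift begins.\<close>
    define a' where "a' = max a0 (Suc a)"
    obtain b c where c: "\<And>k. k \<in> {a'..<b} \<Longrightarrow> \<bar>c k\<bar> \<le> \<delta>" and gt: "1 < norm (\<Sum>k=a'..<b. c k *\<^sub>R y k)"
      using False \<delta> by (meson not_le)
    \<comment> \<open>Failure of the upper estimate gives norm above 1, so normalizing only
      decreases the coefficients and they stay below \<open>\<delta>\<close>.\<close>
    define s where "s = norm (\<Sum>k=a'..<b. c k *\<^sub>R y k)"
    have "1 < s" using gt by (simp add: s_def)
    define w where "w = (\<Sum>k=a'..<b. (c k / s) *\<^sub>R y k)"
    have "w = (1 / s) *\<^sub>R (\<Sum>k=a'..<b. c k *\<^sub>R y k)" by (simp add: w_def scaleR_sum_right)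
    then have w1: "norm w = 1" using \<open>1 < s\<close> by (simp flip: s_def)
    have c': "\<bar>c k / s\<bar> \<le> \<delta>" if "k \<in> {a'..<b}" for k
    proof -
      have "\<bar>c k / s\<bar> \<le> \<bar>c k\<bar>" using \<open>1 < s\<close> by (simp add: abs_divide divide_le_eq mult_le_cancel_left1)
      then show ?thesis using c[of k] that by simp
    qed
    have "a0 \<le> a'" by (simp add: a'_def)
    then obtain v where v: "small_lift \<eta> w (\<iota> (a' - 1)) (\<iota> b) v"
      using small[rule_format, of a' b "\<lambda>k. c k / s"] w1 c' unfolding w_def by auto
    have "a' < b" using w1 unfolding w_def by (rule_tac ccontr) simp
    have ge: "k \<le> \<iota> k" for k using pos by (rule strict_mono_imp_increasing)
    have "a \<le> \<iota> (a' - 1)" using ge[of "a' - 1"] by (simp add: a'_def)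
    then have "small_lift \<eta> w a (\<iota> b) v" using v unfolding small_lift_def by auto
    moreover have "w \<in> span (y ` {a..<\<iota> b})"
      unfolding w_def using ge[of b] by (intro span_sum span_scale[OF span_base]) (auto simp: a'_def)
    moreover have "a < \<iota> b" using \<open>a' < b\<close> ge[of b] by (simp add: a'_def)
    ultimately show ?thesis using w1 unfolding step_def by blast
  qed
  \<comment> \<open>For a lift starting at \<open>a\<close> this is the smallness that
    \<open>schreier_le_sum_blocks\<close> requires, and it keeps the lifting errors summable;
    \<open>a + 1\<close> avoids division by zero.\<close>
  define \<eta> where "\<eta> j a = (1/2)^j / (real a + 1)" for j a :: nat
  have \<eta>: "0 < \<eta> j a" "\<eta> j a \<le> 1" "\<eta> j a * real a \<le> (1/2)^j" "\<eta> j a \<le> (1/2)^j" for j a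
  proof -
    show "0 < \<eta> j a" by (simp add: \<eta>_def)
    have "(1/2)^j \<le> (1::real)" by (simp add: power_le_one)
    show le: "\<eta> j a \<le> (1/2)^j" unfolding \<eta>_def by (simp add: divide_le_eq mult_le_cancel_left1)
    with \<open>(1/2)^j \<le> (1::real)\<close> show "\<eta> j a \<le> 1" by linarith
    show "\<eta> j a * real a \<le> (1/2)^j" unfolding \<eta>_def by (simp add: divide_le_eq)
  qed
  define nxt where "nxt j a = (SOME z. step (\<eta> j a) a (fst z) (fst (snd z)) (snd (snd z)))" for j a
  have nxt: "step (\<eta> j a) a (fst (nxt j a)) (fst (snd (nxt j a))) (snd (snd (nxt j a)))" for j a
  proof -
    have "\<exists>z. step (\<eta> j a) a (fst z) (fst (snd z)) (snd (snd z))"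
      using step_ex[OF \<eta>(1,2)[of j a], of a] by simp
    then show ?thesis unfolding nxt_def by (rule someI_ex)
  qed
  define lo where "lo = rec_nat 0 (\<lambda>j a. fst (nxt j a))"
  define w where "w j = fst (snd (nxt j (lo j)))" for j
  define v where "v j = snd (snd (nxt j (lo j)))" for j
  have st: "step (\<eta> j (lo j)) (lo j) (lo (Suc j)) (w j) (v j)" for j
    using nxt[of j "lo j"] by (simp add: w_def v_def lo_def)
  have lo: "strict_mono lo" unfolding strict_mono_Suc_iff using st by (simp add: step_def)
  have v: "schreier_le (v j) (K + 1)" "\<bar>v j n\<bar> \<le> \<eta> j (lo j)" "n < lo j \<or> lo (Suc j) \<le> n \<Longrightarrow> v j n = 0"
    "norm (w j - lincomb e {..<lo (Suc j)} (v j)) \<le> \<eta> j (lo j)" for j n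
    using st[of j] by (auto simp: step_def small_lift_def)
  show thesis
  proof (rule that[of lo w "C * (K + 3) + 2"])
    show "strict_mono lo" by (rule lo)
    show "w j \<in> span (y ` {lo j..<lo (Suc j)})" "1/2 \<le> norm (w j)" for j
      using st[of j] by (auto simp: step_def)
  next
    show "\<forall>m b. (\<forall>j<m. \<bar>b j\<bar> \<le> 1) \<longrightarrow> norm (\<Sum>j<m. b j *\<^sub>R w j) \<le> C * (K + 3) + 2"
    proof (intro allI impI)
      fix m and b :: "nat \<Rightarrow> real" assume "\<forall>j<m. \<bar>b j\<bar> \<le> 1"
      then have b: "\<bar>b j\<bar> \<le> 1" if "j < m" for j using that by simp
      have "schreier_le (\<lambda>n. \<Sum>j<m. b j * v j n) (K + 1 + 2)"
      proof (rule schreier_le_sum_blocks[where k = lo])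
        show "mono lo" using lo by (rule strict_mono_mono)
      next
        fix j assume "j < m"
        have "\<bar>b j\<bar> * \<bar>v j n\<bar> \<le> 1 * \<bar>v j n\<bar>" for n using b[OF \<open>j < m\<close>] by (intro mult_right_mono) auto
        then have bv: "\<bar>b j * v j n\<bar> \<le> \<bar>v j n\<bar>" for n by (simp add: abs_mult)
        show "schreier_le (\<lambda>n. b j * v j n) (K + 1)"
          by (rule schreier_le_dominated[OF v(1)]) (use bv in auto)
        fix n
        have "\<bar>b j * v j n\<bar> * real (lo j) \<le> \<eta> j (lo j) * real (lo j)"
          using order_trans[OF bv v(2)] by (intro mult_right_mono) auto
        then show "\<bar>b j * v j n\<bar> * real (lo j) \<le> (1/2)^j" using \<eta>(3)[of j "lo j"] by linarith
      qed (use v(3) K_pos in auto)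
      then have le: "schreier_le (\<lambda>n. \<Sum>j<m. b j * v j n) (K + 3)" by (simp add: add.assoc)
      let ?L = "lincomb e {..<lo m}"
      have Lv: "?L (v j) = lincomb e {..<lo (Suc j)} (v j)" if "j < m" for j
        by (rule lincomb_mono_neutral)
          (use that strict_mono_less_eq[OF lo, of "Suc j" m] v(3)[of _ j] in auto)
      have "(\<Sum>j<m. b j *\<^sub>R w j) = ?L (\<lambda>n. \<Sum>j<m. b j * v j n) + (\<Sum>j<m. b j *\<^sub>R (w j - ?L (v j)))"
        by (simp add: lincomb_sum lincomb_cmult scaleR_diff_right sum_subtractf)
      then have "norm (\<Sum>j<m. b j *\<^sub>R w j)
          \<le> norm (?L (\<lambda>n. \<Sum>j<m. b j * v j n)) + norm (\<Sum>j<m. b j *\<^sub>R (w j - ?L (v j)))"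
        by (simp only: norm_triangle_ineq)
      also have "norm (?L (\<lambda>n. \<Sum>j<m. b j * v j n)) \<le> C * (K + 3)"
        using le by (rule lincomb_bound[OF finite_lessThan])
      also have "norm (\<Sum>j<m. b j *\<^sub>R (w j - ?L (v j))) \<le> (\<Sum>j<m. (1/2)^j)"
      proof (rule sum_norm_le)
        fix j assume "j \<in> {..<m}"
        then have "\<bar>b j\<bar> * norm (w j - ?L (v j)) \<le> 1 * (1/2)^j"
          using b[of j] Lv[of j] order_trans[OF v(4)[of j] \<eta>(4)] by (intro mult_mono) auto
        then show "norm (b j *\<^sub>R (w j - ?L (v j))) \<le> (1/2)^j" by simp
      qed
      also have "(\<Sum>j<m. (1/2::real)^j) \<le> 2" by (simp add: sum_gp_strict)
      finally show "norm (\<Sum>j<m. b j *\<^sub>R w j) \<le> C * (K + 3) + 2" by simp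
    qed
  qed
qed

text \<open>The embedding sends \<open>x\<close> to the sum of the series of \<open>x j\<close>
  times \<open>w j\<close>. The upper estimate on tails makes the series Cauchy for null sequences,
  and both estimates pass from partial sums to the limit.\<close>

lemma contains_c0_if_c0_estimates:
  fixes w :: "nat \<Rightarrow> 'a::banach"
  assumes Z: "subspace Z" "closed Z" "\<And>j. w j \<in> Z" and "0 < A"
    and lower: "\<And>m b i. i < m \<Longrightarrow> A * \<bar>b i\<bar> \<le> norm (\<Sum>j<m. b j *\<^sub>R w j)"
    and upper: "\<And>m b. (\<And>j. j < m \<Longrightarrow> \<bar>b j\<bar> \<le> 1) \<Longrightarrow> norm (\<Sum>j<m. b j *\<^sub>R w j) \<le> B"
  shows "contains_c0 Z"
proof -
  have "0 \<le> B" using upper[of 0] by simp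
  have upper': "norm (\<Sum>j<m. b j *\<^sub>R w j) \<le> B * s" if b: "\<And>j. j < m \<Longrightarrow> \<bar>b j\<bar> \<le> s" and "0 \<le> s" for m b s
  proof (cases "s = 0")
    case True
    then show ?thesis using b by simp
  next
    case False
    have "norm (\<Sum>j<m. (b j / s) *\<^sub>R w j) \<le> B"
      using b False \<open>0 \<le> s\<close> by (intro upper) (simp add: divide_le_eq)
    moreover have "(\<Sum>j<m. b j *\<^sub>R w j) = s *\<^sub>R (\<Sum>j<m. (b j / s) *\<^sub>R w j)"
      using False by (simp add: scaleR_sum_right)
    ultimately show ?thesis using \<open>0 \<le> s\<close> by (simp add: mult.commute[of s] mult_right_mono)
  qed
  have summ: "summable (\<lambda>j. x j *\<^sub>R w j)" if x: "x \<in> c0_space" for x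
    unfolding summable_Cauchy
  proof (intro allI impI)
    fix r :: real assume "0 < r"
    define s where "s = r / (B + 1)"
    have "0 < s" using \<open>0 < r\<close> \<open>0 \<le> B\<close> by (simp add: s_def)
    have "x \<longlonglongrightarrow> 0" using x by (simp add: c0_space_def)
    then obtain N where N: "\<And>j. N \<le> j \<Longrightarrow> \<bar>x j\<bar> < s"
      using \<open>0 < s\<close> unfolding LIMSEQ_iff by fastforce
    have "norm (\<Sum>j=p..<q. x j *\<^sub>R w j) < r" if "N \<le> p" for p q
    proof -
      have "(\<Sum>j=p..<q. x j *\<^sub>R w j) = (\<Sum>j<q. (if p \<le> j then x j else 0) *\<^sub>R w j)"
        by (rule sum.mono_neutral_cong_left) auto
      also have "norm \<dots> \<le> B * s"
        using N \<open>0 < s\<close> that by (intro upper') (auto intro: less_imp_le)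
      also have "B * s < (B + 1) * s" using \<open>0 < s\<close> by (simp add: algebra_simps)
      also have "\<dots> = r" using \<open>0 \<le> B\<close> by (simp add: s_def)
      finally show ?thesis .
    qed
    then show "\<exists>N. \<forall>p\<ge>N. \<forall>q. norm (\<Sum>j=p..<q. x j *\<^sub>R w j) < r" by blast
  qed
  define J where "J x = (\<Sum>j. x j *\<^sub>R w j)" for x
  have lim: "(\<lambda>m. \<Sum>j<m. x j *\<^sub>R w j) \<longlonglongrightarrow> J x" if "x \<in> c0_space" for x
    unfolding J_def using summable_LIMSEQ[OF summ[OF that]] .
  have bdd: "bdd_above (range (\<lambda>n. \<bar>x n\<bar>))" if "x \<in> c0_space" for x
  proof -
    have "Bseq x" using that by (auto simp: c0_space_def intro: convergent_imp_Bseq convergentI)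
    then show ?thesis by (auto simp: Bseq_def intro: bdd_aboveI2)
  qed
  show ?thesis
    unfolding contains_c0_def
  proof (intro exI[of _ J] conjI ballI allI)
    fix x z a b assume x: "x \<in> c0_space" and z: "z \<in> c0_space"
    have "(\<lambda>j. (a * x j + b * z j) *\<^sub>R w j) = (\<lambda>j. a *\<^sub>R (x j *\<^sub>R w j) + b *\<^sub>R (z j *\<^sub>R w j))"
      by (simp add: scaleR_add_left)
    then show "J (\<lambda>n. a * x n + b * z n) = a *\<^sub>R J x + b *\<^sub>R J z"
      unfolding J_def using summ[OF x] summ[OF z]
      by (simp only: suminf_add[OF summable_scaleR_right summable_scaleR_right, symmetric]
          suminf_scaleR_right)
  next
    show "J ` c0_space \<subseteq> Z"
    proof
      fix z assume "z \<in> J ` c0_space"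
      then obtain x where x: "x \<in> c0_space" "z = J x" by blast
      have "(\<Sum>j<m. x j *\<^sub>R w j) \<in> Z" for m
        using Z by (intro subspace_sum subspace_scale) auto
      then show "z \<in> Z" using closed_sequentially[OF Z(2) _ lim[OF x(1)]] x(2) by blast
    qed
  next
    show "\<exists>A B. 0 < A \<and> 0 < B \<and> (\<forall>x\<in>c0_space. A * sup_norm x \<le> norm (J x) \<and> norm (J x) \<le> B * sup_norm x)"
    \<comment> \<open>Only \<open>0 \<le> B\<close> has been established, while the definition asks
      for a positive constant.\<close>
    proof (rule exI[of _ A], rule exI[of _ "B + 1"], intro conjI ballI)
      show "0 < A" "0 < B + 1" using \<open>0 < A\<close> \<open>0 \<le> B\<close> by auto
      fix x assume x: "x \<in> c0_space"
      note nlim = tendsto_norm[OF lim[OF x]]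
      have le: "\<bar>x n\<bar> \<le> sup_norm x" for n unfolding sup_norm_def by (rule cSUP_upper[OF UNIV_I bdd[OF x]])
      then have "0 \<le> sup_norm x" by (meson abs_ge_zero order_trans)
      have "A * \<bar>x n\<bar> \<le> norm (J x)" for n
        by (rule Lim_bounded2[OF nlim, of "Suc n"]) (auto intro: lower)
      then have "\<bar>x n\<bar> \<le> norm (J x) / A" for n using \<open>0 < A\<close> by (simp add: field_simps)
      then have "sup_norm x \<le> norm (J x) / A" unfolding sup_norm_def by (intro cSUP_least) auto
      then show "A * sup_norm x \<le> norm (J x)" using \<open>0 < A\<close> by (simp add: field_simps)
      have "norm (J x) \<le> B * sup_norm x"
        by (rule Lim_bounded[OF nlim, of 0]) (use le \<open>0 \<le> sup_norm x\<close> in \<open>auto intro: upper'\<close>)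
      also have "\<dots> \<le> (B + 1) * sup_norm x" using \<open>0 \<le> sup_norm x\<close> by (simp add: algebra_simps)
      finally show "norm (J x) \<le> (B + 1) * sup_norm x" .
    qed
  qed
qed

theorem theoremB:
  fixes T :: "(nat \<Rightarrow> real) \<Rightarrow> 'a::banach"
  assumes "quotient_of_schreier T"
  shows "c0_saturated (UNIV :: 'a set)"
  unfolding c0_saturated_def
proof (intro allI impI, elim conjE)
  fix Z :: "'a set" assume Z: "subspace Z" "closed Z" "infinite_dimensional Z"
  obtain e C K where "schreier_lifting (e :: nat \<Rightarrow> 'a) C K"
    using assms by (rule schreier_lifting_if_quotient)
  then interpret schreier_lifting e C K .
  obtain y u pos where "schreier_blocks e C K y u pos" and yZ: "range y \<subseteq> Z"
    by (rule schreier_blocks_exist[OF Z(1,3)])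
  then interpret B: schreier_blocks e C K y u pos by simp
  obtain s where "schreier_mazur e C K (y \<circ> s) (u \<circ> s) (pos \<circ> s)"
    by (rule B.mazur_subsequence)
  then interpret M: schreier_mazur e C K "y \<circ> s" "u \<circ> s" "pos \<circ> s" .
  obtain \<iota> \<phi> where "schreier_ramps e C K (y \<circ> s \<circ> \<iota>) (u \<circ> s \<circ> \<iota>) \<iota> \<phi>"
    by (rule M.ramps_subsequence)
  then interpret R: schreier_ramps e C K "y \<circ> s \<circ> \<iota>" "u \<circ> s \<circ> \<iota>" \<iota> \<phi> .
  obtain lo w B where w: "strict_mono lo" "\<And>j. w j \<in> span ((y \<circ> s \<circ> \<iota>) ` {lo j..<lo (Suc j)})"
    "\<And>j. 1/2 \<le> norm (w j)" and B: "\<forall>m b. (\<forall>j<m. \<bar>b j\<bar> \<le> 1) \<longrightarrow> norm (\<Sum>j<m. b j *\<^sub>R w j) \<le> B"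
    by (rule R.c0_blocks) (rule that)
  show "contains_c0 Z"
  proof (rule contains_c0_if_c0_estimates[OF Z(1,2)])
    show "w j \<in> Z" for j
      using w(2)[of j] span_minimal[OF _ Z(1), of "(y \<circ> s \<circ> \<iota>) ` {lo j..<lo (Suc j)}"] yZ by auto
    show "1/8 * \<bar>b i\<bar> \<le> norm (\<Sum>j<m. b j *\<^sub>R w j)" if "i < m" for m b i
      using w that by (rule R.basic_block_coefficient)
    show "norm (\<Sum>j<m. b j *\<^sub>R w j) \<le> B" if "\<And>j. j < m \<Longrightarrow> \<bar>b j\<bar> \<le> 1" for m b
      using B that by blast
  qed simp
qed

end
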